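(* With the notation of the context, fix all parameters other than $\mathring d$ and let $\mathring d\to\infty$. Then, entrywise, $$\mathbf J(\boldsymbol\gamma)=\frac{2E}{N_0}\,\mathbf T+o(\mathring d^{-4}),\qquad \mathbf T=\begin{bmatrix}\mathbf T_{11}&\mathbf T_{21}^{\mathsf T}\\ \mathbf T_{21}&\mathbf T_{22}\end{bmatrix},$$ where $$\mathbf T_{11}=\begin{bmatrix} L & A & -A \\ A & Z+B & -B \\ -A & -B & B \end{bmatrix},\quad A=L\langle\bar w,\bar w\,\bar{\mathbf p}_\perp^{\mathsf T}\mathbf R\boldsymbol\rho\rangle_\star,\quad B=L\|\bar w\,\bar{\mathbf p}_\perp^{\mathsf T}\mathbf R\boldsymbol\rho\|_\star^2+(\alpha+1)^2\|\operatorname{P}_w^\perp(v)\|_\star^2/\|w\|_\star^2,$$ $$\mathbf T_{21}=[\,\mathbf c\ \ \mathbf q\ \ -\mathbf q\,]\in\mathbb R^{2Q\times3},\qquad \mathbf T_{22}=L\langle\bar w\,\mathbf s,\bar w\,\mathbf s\rangle_\star+(\alpha+1)^2\langle\mathbf t,\mathbf t\rangle_\star/\|w\|_\star^2\in\mathbb R^{2Q\times2Q},$$ $$\mathbf c=L\langle\bar w\,\mathbf s,\bar w\rangle_\star,\qquad \mathbf q=L\langle\bar w\,\mathbf s,\bar w\,\bar{\mathbf p}_\perp^{\mathsf T}\mathbf R\boldsymbol\rho\rangle_\star+(\alpha+1)^2\langle\mathbf t,\operatorname{P}_w^\perp(v)\rangle_\star/\|w\|_\star^2,$$ $$\mathbf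 s=\begin{bmatrix}([1\ 0]\mathbf R^{\mathsf T}\bar{\mathbf p})\,\boldsymbol\sigma\\ ([0\ 1]\mathbf R^{\mathsf T}\bar{\mathbf p})\,\boldsymbol\varsigma\end{bmatrix},\qquad \mathbf t=\operatorname{P}_w^\perp\!\left(v\,\|\dot{\boldsymbol\rho}\|^{-2}\begin{bmatrix}(\dot{\boldsymbol\varsigma}^{\mathsf T}\mathbf n)\,\dot{\boldsymbol\sigma}\\ -(\dot{\boldsymbol\sigma}^{\mathsf T}\mathbf m)\,\dot{\boldsymbol\varsigma}\end{bmatrix}\right),$$ with $\bar w=w/\|w\|_\star$, $\bar{\mathbf p}=\mathbf p/\|\mathbf p\|$, $\bar{\mathbf p}_\perp=\mathbf p_\perp/\|\mathbf p_\perp\|$ (Euclidean norms) and $Z=M\cos^2\mathring\phi$.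
   Context: Contour. Fix $Q\ge 1$, $\mathbf m=[a_1,\dots,a_Q]^{\mathsf T}$, $\mathbf n=[b_1,\dots,b_Q]^{\mathsf T}\in\mathbb R^Q$ with $a_1,b_1>0$. For $u\in[0,2\pi]$ let $\boldsymbol\sigma(u)=[\cos u,\dots,\cos Qu]^{\mathsf T}$, $\boldsymbol\varsigma(u)=[\sin u,\dots,\sin Qu]^{\mathsf T}$, $\boldsymbol\rho(u)=[\boldsymbol\sigma^{\mathsf T}\mathbf m,\ \boldsymbol\varsigma^{\mathsf T}\mathbf n]^{\mathsf T}\in\mathbb R^2$, and assume $\dot{\boldsymbol\rho}(u)\ne0$ for all $u$ (dot is $\partial/\partial u$). For $\mathring d>0$ and angles $\mathring\phi,\varphi$ let $\mathbf p=\mathring d[\cos\mathring\phi,\sin\mathring\phi]^{\mathsf T}$, $\mathbf R=\begin{bmatrix}\cos\varphi&-\sin\varphi\\ \sin\varphi&\cos\varphi\end{bmatrix}$, $\mathbf r(u)=\mathbf p+\mathbf R\boldsymbol\rho(u)$ (nonzero for all $u$ when $\mathring d$ is large). Let $d(u)=\|\mathbf r(u)\|$, $\phi(u)$ the polar angle of $\mathbf r(u)$, $\beta(u)$ the polar angle of $\dot{\mathbf r}(u)$. For $\mathbf x\in\mathbb R^2$, $\mathbf x_\perp=\left(\begin{smallmatrix}0&-1\\ 1&0\end{smallmatrix}\right)\mathbf x$. Parameter vector: $\boldsymbol\gamma=[\mathring d,\mathring\phi,\varphi,a_1,\dots,a_Q,b_1,\dots,b_Q]^{\mathsf T}\in\mathbb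 R^{2Q+3}$; derivatives with respect to $\boldsymbol\gamma$ are at fixed $u$, with angles on locally smooth branches. Set $\boldsymbol\mu=\partial d/\partial\boldsymbol\gamma$, $\boldsymbol\eta=\partial\phi/\partial\boldsymbol\gamma$, $\boldsymbol\xi=\boldsymbol\eta-\partial\beta/\partial\boldsymbol\gamma$ (functions of $u$). Let $\overline{\sin}\,x=\max(\sin x,0)$, $\alpha\ge0$ a constant (for $\alpha=0$, $(\overline{\sin}\,x)^0$ means $1$ if $\sin x>0$, else $0$), $w=(\overline{\sin}(\phi-\beta))^{\alpha+1}$, $v=(\overline{\sin}(\phi-\beta))^{\alpha}\cos(\phi-\beta)$. Star product: $\langle f_1,f_2\rangle_\star=\int_0^{2\pi}f_1f_2\|\dot{\mathbf r}(u)\|du$, $\|f\|_\star=\langle f,f\rangle_\star^{1/2}$; for vector functions $\langle\mathbf f_1,\mathbf f_2\rangle_\star=\int_0^{2\pi}\mathbf f_1\mathbf f_2^{\mathsf T}\|\dot{\mathbf r}\|du$. $\operatorname{P}_w^\perp(\mathbf f)=\mathbf f-\langle\mathbf f,w\rangle_\star\|w\|_\star^{-2}w$. Constants: $N\ge1$ (antennas), $N_0>0$, $B_{\mathrm{RMS}}>0$, $c>0$, $L=(4\pi B_{\mathrm{RMS}}/c)^2$, $M=\pi^2(N^2-1)/12$; the gain is $g=\sqrt G/\mathring d^2$ with $G>0$ a constant independent of $\mathring d$; received energy $E=g^2N\|w\|_\star^2$. Effective Fisher information matrix: $$\mathbf J(\boldsymbol\gamma)=\frac1{\|w\|_\star^2}\frac{2E}{N_0}\Big[L\langle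 w\boldsymbol\mu,w\boldsymbol\mu\rangle_\star+M\langle w\cos\phi\,\boldsymbol\eta,w\cos\phi\,\boldsymbol\eta\rangle_\star+(\alpha+1)^2\langle\operatorname{P}_w^\perp(v\boldsymbol\xi),\operatorname{P}_w^\perp(v\boldsymbol\xi)\rangle_\star\Big].$$ *)

theory Defs
  imports "HOL-Analysis.Analysis" "HOL-Library.Landau_Symbols"
begin

section \<open>The contour\<close>

text \<open>
  Vectors whose length depends on \<open>Q\<close> are functions on \<open>nat\<close>, read on \<open>{1..n}\<close>; matrices likewise.
  Elements of the plane are in \<open>real^2\<close>.
\<close>

definition sigma :: "nat \<Rightarrow> real \<Rightarrow> real"
  where "sigma k u = cos (real k * u)"

definition varsigma :: "nat \<Rightarrow> real \<Rightarrow> real"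
  where "varsigma k u = sin (real k * u)"

definition rho :: "nat \<Rightarrow> (nat \<Rightarrow> real) \<Rightarrow> (nat \<Rightarrow> real) \<Rightarrow> real \<Rightarrow> real^2"
  where "rho Q a b u = vector [\<Sum>k=1..Q. sigma k u * a k, \<Sum>k=1..Q. varsigma k u * b k]"

definition rot :: "real \<Rightarrow> real^2^2"
  where "rot \<psi> = vector [vector [cos \<psi>, - sin \<psi>], vector [sin \<psi>, cos \<psi>]]"

definition perp :: "real^2 \<Rightarrow> real^2"
  where "perp x = (vector [vector [0, -1], vector [1, 0]] :: real^2^2) *v x"

text \<open>
  The parameter vector \<open>\<gamma>\<close>, with entries \<open>1..2Q+3\<close>: distance \<open>d0\<close> and direction \<open>\<phi>0\<close> of the
  centre, orientation \<open>\<psi>\<close>, then \<open>a\<^sub>1, \<dots>, a\<^sub>Q, b\<^sub>1, \<dots>, b\<^sub>Q\<close>.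
\<close>

definition params ::
  "nat \<Rightarrow> real \<Rightarrow> real \<Rightarrow> real \<Rightarrow> (nat \<Rightarrow> real) \<Rightarrow> (nat \<Rightarrow> real) \<Rightarrow> nat \<Rightarrow> real"
  where "params Q d0 \<phi>0 \<psi> a b i =
    (if i = 1 then d0 else if i = 2 then \<phi>0 else if i = 3 then \<psi>
     else if i \<le> 3 + Q then a (i - 3) else b (i - 3 - Q))"

definition acoef :: "(nat \<Rightarrow> real) \<Rightarrow> nat \<Rightarrow> real"
  where "acoef \<gamma> k = \<gamma> (3 + k)"

definition bcoef :: "nat \<Rightarrow> (nat \<Rightarrow> real) \<Rightarrow> nat \<Rightarrow> real"
  where "bcoef Q \<gamma> k = \<gamma> (3 + Q + k)"

definition centre :: "(nat \<Rightarrow> real) \<Rightarrow> real^2"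
  where "centre \<gamma> = \<gamma> 1 *\<^sub>R vector [cos (\<gamma> 2), sin (\<gamma> 2)]"

definition contour :: "nat \<Rightarrow> (nat \<Rightarrow> real) \<Rightarrow> real \<Rightarrow> real^2"
  where "contour Q \<gamma> u = centre \<gamma> + rot (\<gamma> 3) *v rho Q (acoef \<gamma>) (bcoef Q \<gamma>) u"

definition tangent :: "nat \<Rightarrow> (nat \<Rightarrow> real) \<Rightarrow> real \<Rightarrow> real^2"
  where "tangent Q \<gamma> u = vector_derivative (contour Q \<gamma>) (at u)"

section \<open>Distance, angles and their derivatives in the parameters\<close>

definition is_angle_of :: "real \<Rightarrow> real^2 \<Rightarrow> bool"
  where "is_angle_of \<theta> x \<longleftrightarrow> x = norm x *\<^sub>R vector [cos \<theta>, sin \<theta>]"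

definition polar_angle :: "real^2 \<Rightarrow> real"
  where "polar_angle x = Arg (Complex (x $ 1) (x $ 2))"

text \<open>
  The derivative of the polar angle of \<open>f\<close> at \<open>t\<close> is that of any local branch of the angle which is
  differentiable at \<open>t\<close>, rather than that of the principal value, which jumps on the negative real
  axis. If \<open>f\<close> is continuous and nonzero at \<open>t\<close>, two such branches differ near \<open>t\<close> by a constant
  multiple of \<open>2\<pi>\<close>, so the derivative is unique.
\<close>

definition angle_deriv :: "(real \<Rightarrow> real^2) \<Rightarrow> real \<Rightarrow> real"
  where "angle_deriv f t =
    (THE D. \<exists>\<theta>. (\<forall>\<^sub>F s in nhds t. is_angle_of (\<theta> s) (f s)) \<and> (\<theta> has_real_derivative D) (at t))"

definition dist_r :: "nat \<Rightarrow> (nat \<Rightarrow> real) \<Rightarrow> real \<Rightarrow> real"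
  where "dist_r Q \<gamma> u = norm (contour Q \<gamma> u)"

definition phi :: "nat \<Rightarrow> (nat \<Rightarrow> real) \<Rightarrow> real \<Rightarrow> real"
  where "phi Q \<gamma> u = polar_angle (contour Q \<gamma> u)"

definition beta :: "nat \<Rightarrow> (nat \<Rightarrow> real) \<Rightarrow> real \<Rightarrow> real"
  where "beta Q \<gamma> u = polar_angle (tangent Q \<gamma> u)"

definition mu :: "nat \<Rightarrow> (nat \<Rightarrow> real) \<Rightarrow> nat \<Rightarrow> real \<Rightarrow> real"
  where "mu Q \<gamma> i u = deriv (\<lambda>x. dist_r Q (\<gamma>(i := x)) u) (\<gamma> i)"

definition eta :: "nat \<Rightarrow> (nat \<Rightarrow> real) \<Rightarrow> nat \<Rightarrow> real \<Rightarrow> real"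
  where "eta Q \<gamma> i u = angle_deriv (\<lambda>x. contour Q (\<gamma>(i := x)) u) (\<gamma> i)"

definition xi :: "nat \<Rightarrow> (nat \<Rightarrow> real) \<Rightarrow> nat \<Rightarrow> real \<Rightarrow> real"
  where "xi Q \<gamma> i u = eta Q \<gamma> i u - angle_deriv (\<lambda>x. tangent Q (\<gamma>(i := x)) u) (\<gamma> i)"

section \<open>Weights and star product\<close>

definition sinbar :: "real \<Rightarrow> real"
  where "sinbar x = max (sin x) 0"

text \<open>\<open>0 powr \<alpha> = 0\<close> also for \<open>\<alpha> = 0\<close>, while \<open>x powr 0 = 1\<close> for \<open>x > 0\<close>.\<close>

definition wt :: "nat \<Rightarrow> real \<Rightarrow> (nat \<Rightarrow> real) \<Rightarrow> real \<Rightarrow> real"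
  where "wt Q \<alpha> \<gamma> u = sinbar (phi Q \<gamma> u - beta Q \<gamma> u) powr (\<alpha> + 1)"

definition vt :: "nat \<Rightarrow> real \<Rightarrow> (nat \<Rightarrow> real) \<Rightarrow> real \<Rightarrow> real"
  where "vt Q \<alpha> \<gamma> u =
    sinbar (phi Q \<gamma> u - beta Q \<gamma> u) powr \<alpha> * cos (phi Q \<gamma> u - beta Q \<gamma> u)"

definition star :: "nat \<Rightarrow> (nat \<Rightarrow> real) \<Rightarrow> (real \<Rightarrow> real) \<Rightarrow> (real \<Rightarrow> real) \<Rightarrow> real"
  where "star Q \<gamma> f g =
    set_lebesgue_integral lborel {0..2 * pi} (\<lambda>u. f u * g u * norm (tangent Q \<gamma> u))"

definition star_norm :: "nat \<Rightarrow> (nat \<Rightarrow> real) \<Rightarrow> (real \<Rightarrow> real) \<Rightarrow> real"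
  where "star_norm Q \<gamma> f = sqrt (star Q \<gamma> f f)"

definition proj_perp ::
  "nat \<Rightarrow> real \<Rightarrow> (nat \<Rightarrow> real) \<Rightarrow> (real \<Rightarrow> real) \<Rightarrow> real \<Rightarrow> real"
  where "proj_perp Q \<alpha> \<gamma> f u =
    f u - star Q \<gamma> f (wt Q \<alpha> \<gamma>) / (star_norm Q \<gamma> (wt Q \<alpha> \<gamma>))\<^sup>2 * wt Q \<alpha> \<gamma> u"

section \<open>The effective Fisher information matrix\<close>

definition L_const :: "real \<Rightarrow> real \<Rightarrow> real"
  where "L_const B_RMS c = (4 * pi * B_RMS / c)\<^sup>2"

definition M_const :: "nat \<Rightarrow> real"
  where "M_const N = pi\<^sup>2 * ((real N)\<^sup>2 - 1) / 12"

definition gain :: "real \<Rightarrow> (nat \<Rightarrow> real) \<Rightarrow> real"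
  where "gain G \<gamma> = sqrt G / (\<gamma> 1)\<^sup>2"

definition energy :: "nat \<Rightarrow> real \<Rightarrow> nat \<Rightarrow> real \<Rightarrow> (nat \<Rightarrow> real) \<Rightarrow> real"
  where "energy Q \<alpha> N G \<gamma> = (gain G \<gamma>)\<^sup>2 * real N * (star_norm Q \<gamma> (wt Q \<alpha> \<gamma>))\<^sup>2"

definition efim ::
  "nat \<Rightarrow> real \<Rightarrow> real \<Rightarrow> real \<Rightarrow> nat \<Rightarrow> real \<Rightarrow> real \<Rightarrow> (nat \<Rightarrow> real) \<Rightarrow> nat \<Rightarrow> nat \<Rightarrow> real"
  where "efim Q \<alpha> B_RMS c N N0 G \<gamma> i j =
    1 / (star_norm Q \<gamma> (wt Q \<alpha> \<gamma>))\<^sup>2 * (2 * energy Q \<alpha> N G \<gamma> / N0) *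
    (L_const B_RMS c *
        star Q \<gamma> (\<lambda>u. wt Q \<alpha> \<gamma> u * mu Q \<gamma> i u) (\<lambda>u. wt Q \<alpha> \<gamma> u * mu Q \<gamma> j u)
     + M_const N *
        star Q \<gamma> (\<lambda>u. wt Q \<alpha> \<gamma> u * cos (phi Q \<gamma> u) * eta Q \<gamma> i u)
                 (\<lambda>u. wt Q \<alpha> \<gamma> u * cos (phi Q \<gamma> u) * eta Q \<gamma> j u)
     + (\<alpha> + 1)\<^sup>2 *
        star Q \<gamma> (proj_perp Q \<alpha> \<gamma> (\<lambda>u. vt Q \<alpha> \<gamma> u * xi Q \<gamma> i u))
                 (proj_perp Q \<alpha> \<gamma> (\<lambda>u. vt Q \<alpha> \<gamma> u * xi Q \<gamma> j u)))"

section \<open>The limiting matrix\<close>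

definition wbar :: "nat \<Rightarrow> real \<Rightarrow> (nat \<Rightarrow> real) \<Rightarrow> real \<Rightarrow> real"
  where "wbar Q \<alpha> \<gamma> u = wt Q \<alpha> \<gamma> u / star_norm Q \<gamma> (wt Q \<alpha> \<gamma>)"

definition pbar :: "(nat \<Rightarrow> real) \<Rightarrow> real^2"
  where "pbar \<gamma> = centre \<gamma> /\<^sub>R norm (centre \<gamma>)"

definition pbar_perp :: "(nat \<Rightarrow> real) \<Rightarrow> real^2"
  where "pbar_perp \<gamma> = perp (centre \<gamma>) /\<^sub>R norm (perp (centre \<gamma>))"

definition wpr :: "nat \<Rightarrow> real \<Rightarrow> (nat \<Rightarrow> real) \<Rightarrow> real \<Rightarrow> real"
  where "wpr Q \<alpha> \<gamma> u =
    wbar Q \<alpha> \<gamma> u * (pbar_perp \<gamma> \<bullet> (rot (\<gamma> 3) *v rho Q (acoef \<gamma>) (bcoef Q \<gamma>) u))"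

definition s_vec :: "nat \<Rightarrow> (nat \<Rightarrow> real) \<Rightarrow> nat \<Rightarrow> real \<Rightarrow> real"
  where "s_vec Q \<gamma> k u =
    (if k \<le> Q then (transpose (rot (\<gamma> 3)) *v pbar \<gamma>) $ 1 * sigma k u
     else (transpose (rot (\<gamma> 3)) *v pbar \<gamma>) $ 2 * varsigma (k - Q) u)"

definition ws_vec :: "nat \<Rightarrow> real \<Rightarrow> (nat \<Rightarrow> real) \<Rightarrow> nat \<Rightarrow> real \<Rightarrow> real"
  where "ws_vec Q \<alpha> \<gamma> k u = wbar Q \<alpha> \<gamma> u * s_vec Q \<gamma> k u"

definition t_vec :: "nat \<Rightarrow> real \<Rightarrow> (nat \<Rightarrow> real) \<Rightarrow> nat \<Rightarrow> real \<Rightarrow> real"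
  where "t_vec Q \<alpha> \<gamma> k = proj_perp Q \<alpha> \<gamma> (\<lambda>u.
    vt Q \<alpha> \<gamma> u / (norm (vector_derivative (rho Q (acoef \<gamma>) (bcoef Q \<gamma>)) (at u)))\<^sup>2 *
    (if k \<le> Q then (\<Sum>l=1..Q. deriv (varsigma l) u * bcoef Q \<gamma> l) * deriv (sigma k) u
     else - (\<Sum>l=1..Q. deriv (sigma l) u * acoef \<gamma> l) * deriv (varsigma (k - Q)) u))"

definition A_const :: "nat \<Rightarrow> real \<Rightarrow> real \<Rightarrow> (nat \<Rightarrow> real) \<Rightarrow> real"
  where "A_const Q \<alpha> L \<gamma> = L * star Q \<gamma> (wbar Q \<alpha> \<gamma>) (wpr Q \<alpha> \<gamma>)"

definition B_const :: "nat \<Rightarrow> real \<Rightarrow> real \<Rightarrow> (nat \<Rightarrow> real) \<Rightarrow> real"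
  where "B_const Q \<alpha> L \<gamma> =
    L * (star_norm Q \<gamma> (wpr Q \<alpha> \<gamma>))\<^sup>2
    + (\<alpha> + 1)\<^sup>2 * (star_norm Q \<gamma> (proj_perp Q \<alpha> \<gamma> (vt Q \<alpha> \<gamma>)))\<^sup>2
      / (star_norm Q \<gamma> (wt Q \<alpha> \<gamma>))\<^sup>2"

definition Z_const :: "real \<Rightarrow> (nat \<Rightarrow> real) \<Rightarrow> real"
  where "Z_const M \<gamma> = M * (cos (\<gamma> 2))\<^sup>2"

definition c_vec :: "nat \<Rightarrow> real \<Rightarrow> real \<Rightarrow> (nat \<Rightarrow> real) \<Rightarrow> nat \<Rightarrow> real"
  where "c_vec Q \<alpha> L \<gamma> k = L * star Q \<gamma> (ws_vec Q \<alpha> \<gamma> k) (wbar Q \<alpha> \<gamma>)"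

definition q_vec :: "nat \<Rightarrow> real \<Rightarrow> real \<Rightarrow> (nat \<Rightarrow> real) \<Rightarrow> nat \<Rightarrow> real"
  where "q_vec Q \<alpha> L \<gamma> k =
    L * star Q \<gamma> (ws_vec Q \<alpha> \<gamma> k) (wpr Q \<alpha> \<gamma>)
    + (\<alpha> + 1)\<^sup>2 * star Q \<gamma> (t_vec Q \<alpha> \<gamma> k) (proj_perp Q \<alpha> \<gamma> (vt Q \<alpha> \<gamma>))
      / (star_norm Q \<gamma> (wt Q \<alpha> \<gamma>))\<^sup>2"

definition T11 :: "nat \<Rightarrow> real \<Rightarrow> real \<Rightarrow> real \<Rightarrow> (nat \<Rightarrow> real) \<Rightarrow> nat \<Rightarrow> nat \<Rightarrow> real"
  where "T11 Q \<alpha> L M \<gamma> i j =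
    (let A = A_const Q \<alpha> L \<gamma>; B = B_const Q \<alpha> L \<gamma>; Z = Z_const M \<gamma>
     in [[ L,     A,  -A],
         [ A, Z + B,  -B],
         [-A,    -B,   B]] ! (i - 1) ! (j - 1))"

definition T21 :: "nat \<Rightarrow> real \<Rightarrow> real \<Rightarrow> (nat \<Rightarrow> real) \<Rightarrow> nat \<Rightarrow> nat \<Rightarrow> real"
  where "T21 Q \<alpha> L \<gamma> k j =
    [c_vec Q \<alpha> L \<gamma> k, q_vec Q \<alpha> L \<gamma> k, - q_vec Q \<alpha> L \<gamma> k] ! (j - 1)"

definition T22 :: "nat \<Rightarrow> real \<Rightarrow> real \<Rightarrow> (nat \<Rightarrow> real) \<Rightarrow> nat \<Rightarrow> nat \<Rightarrow> real"
  where "T22 Q \<alpha> L \<gamma> k l =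
    L * star Q \<gamma> (ws_vec Q \<alpha> \<gamma> k) (ws_vec Q \<alpha> \<gamma> l)
    + (\<alpha> + 1)\<^sup>2 * star Q \<gamma> (t_vec Q \<alpha> \<gamma> k) (t_vec Q \<alpha> \<gamma> l)
      / (star_norm Q \<gamma> (wt Q \<alpha> \<gamma>))\<^sup>2"

definition T_mat :: "nat \<Rightarrow> real \<Rightarrow> real \<Rightarrow> real \<Rightarrow> (nat \<Rightarrow> real) \<Rightarrow> nat \<Rightarrow> nat \<Rightarrow> real"
  where "T_mat Q \<alpha> L M \<gamma> i j =
    (if i \<le> 3 then (if j \<le> 3 then T11 Q \<alpha> L M \<gamma> i j else T21 Q \<alpha> L \<gamma> (j - 3) i)
     else (if j \<le> 3 then T21 Q \<alpha> L \<gamma> (i - 3) j else T22 Q \<alpha> L \<gamma> (i - 3) (j - 3)))"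

end

(*
  The tangent, hence the arc length measure and beta, does not depend on the distance d of the
  centre, whereas r(u)/|r(u)| tends to the unit vector p/|p|, d/|r(u)| to 1 and 1/|r(u)| to 0,
  uniformly in u. So mu, eta and xi converge uniformly, and since the weights are bounded, every
  star product may be replaced by the one of the limits, up to o(1); the projections need |w|^2
  bounded away from 0. The latter holds because a closed curve with nonvanishing tangent cannot
  move monotonically in the direction orthogonal to p. The prefactor 2E/(N0 |w|^2) is exactly
  2 N G / (N0 d^4).
*)

theory Submission
  imports Defs
begin

section \<open>Plane geometry and polar angles\<close>

text \<open>\<open>T_mat\<close> is itself taken at distance d, with the weights of that distance.
  This matters because at \<alpha> = 0 the weight \<open>vt\<close> contains the indicator of a
  positive sine, which jumps and need not converge uniformly. So no limit of the weights is ever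
  formed: both sides carry the same \<open>wt\<close> and \<open>vt\<close>, known only to be
  measurable and bounded, while \<open>mu\<close>, \<open>eta\<close>, \<open>xi\<close> and the
  cosine of \<open>phi\<close> are exchanged for their limits. Closeness is therefore a relation
  between two families that both move with d.

  The delicate parameter is the bearing of the centre (i = 2): its derivative of the contour grows
  like d, but is orthogonal to the limiting line of sight, so \<open>mu\<close> has a finite limit,
  and divided by the distance it is the only one to survive in \<open>eta\<close>.

  The signs in T have a geometric source: increasing the bearing and the orientation \<psi> together
  is a rigid rotation about the origin. It changes neither distances nor \<open>phi - beta\<close>,
  so the entries 2 and 3 of \<open>mu\<close> and of \<open>xi\<close> are opposite. It does change
  \<open>phi\<close>, and in the limit only through the bearing, which is why Z occurs once.\<close>

lemma vector_eq_2: "x = y \<longleftrightarrow> x $ 1 = y $ 1 \<and> x $ 2 = y $ 2" for x y :: "'a^2"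
  by (simp add: vec_eq_iff forall_2)

lemma inner_2: "x \<bullet> y = x $ 1 * y $ 1 + x $ 2 * y $ 2" for x y :: "real^2"
  by (simp add: inner_vec_def sum_2)

lemma norm_2: "norm x = sqrt ((x $ 1)\<^sup>2 + (x $ 2)\<^sup>2)" for x :: "real^2"
  by (simp add: norm_eq_sqrt_inner inner_2 power2_eq_square)

lemma norm_vector_2_le: "norm (vector [x, y] :: real^2) \<le> \<bar>x\<bar> + \<bar>y\<bar>"
  by (simp add: norm_2 sqrt_sum_squares_le_sum_abs)

lemma perp_nth [simp]: "perp x $ 1 = - x $ 2" "perp x $ 2 = x $ 1"
  by (simp_all add: perp_def matrix_vector_mult_def sum_2)

lemma rot_mult_nth [simp]:
  "(rot \<psi> *v x) $ 1 = cos \<psi> * x $ 1 - sin \<psi> * x $ 2"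
  "(rot \<psi> *v x) $ 2 = sin \<psi> * x $ 1 + cos \<psi> * x $ 2"
  by (simp_all add: rot_def matrix_vector_mult_def sum_2)

text \<open>\<open>x v* rot \<psi>\<close> is the transposed rotation applied to \<open>x\<close>,
  as it occurs in \<open>s_vec\<close>.\<close>

lemma mult_rot_nth:
  "(x v* rot \<psi>) $ 1 = cos \<psi> * x $ 1 + sin \<psi> * x $ 2"
  "(x v* rot \<psi>) $ 2 = cos \<psi> * x $ 2 - sin \<psi> * x $ 1"
  by (simp_all add: rot_def vector_matrix_mult_def sum_2)

lemma norm_perp [simp]: "norm (perp x) = norm x"
  by (simp add: norm_2 add.commute)

lemma inner_perp_perp [simp]: "perp x \<bullet> perp y = x \<bullet> y"
  by (simp add: inner_2)

lemma perp_inner_left: "perp x \<bullet> y = - (x \<bullet> perp y)"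
  by (simp add: inner_2)

lemma inner_perp_self [simp]: "perp x \<bullet> x = 0" "x \<bullet> perp x = 0"
  by (simp_all add: inner_2)

lemma perp_scaleR: "perp (c *\<^sub>R x) = c *\<^sub>R perp x"
  by (simp add: vector_eq_2)

lemma inner_rot_rot [simp]: "(rot \<psi> *v x) \<bullet> (rot \<psi> *v y) = x \<bullet> y"
proof -
  have "(rot \<psi> *v x) \<bullet> (rot \<psi> *v y)
    = ((sin \<psi>)\<^sup>2 + (cos \<psi>)\<^sup>2) * (x $ 1 * y $ 1 + x $ 2 * y $ 2)"
    unfolding inner_2 rot_mult_nth
    by (simp add: algebra_simps power2_eq_square del: sin_cos_squared_add3)
  then show ?thesis by (simp add: inner_2)
qed

lemma norm_rot [simp]: "norm (rot \<psi> *v x) = norm x"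
  by (simp add: norm_eq_sqrt_inner)

lemma perp_rot: "perp (rot \<psi> *v x) = rot \<psi> *v perp x"
  by (simp add: vector_eq_2)

lemma norm_cos_sin [simp]: "norm (vector [cos \<theta>, sin \<theta>] :: real^2) = 1"
  by (simp add: norm_2)

section \<open>Derivatives of norms and polar angles along plane curves\<close>

lemma has_vector_derivative_vector_2:
  assumes "(f has_real_derivative f') (at t)" "(g has_real_derivative g') (at t)"
  shows "((\<lambda>x. vector [f x, g x] :: real^2) has_vector_derivative vector [f', g']) (at t)"
proof -
  have eq: "vector [s, t] = s *\<^sub>R (vector [1, 0] :: real^2) + t *\<^sub>R vector [0, 1]" for s t
    by (simp add: vector_eq_2)
  show ?thesis
    unfolding eq[of "f _" "g _"] eq[of f' g']
    using assms
    by (intro has_vector_derivative_add has_vector_derivative_scaleR[OF _ has_vector_derivative_const, simplified])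
qed

lemma has_vector_derivative_nth:
  assumes "(f has_vector_derivative f') F"
  shows "((\<lambda>x. f x $ k) has_real_derivative f' $ k) F"
  using bounded_linear.has_vector_derivative[OF bounded_linear_vec_nth assms]
  by (simp add: has_real_derivative_iff_has_vector_derivative)

lemma deriv_norm:
  fixes f :: "real \<Rightarrow> real^2"
  assumes f: "(f has_vector_derivative f') (at t)" and "f t \<noteq> 0"
  shows "((\<lambda>x. norm (f x)) has_real_derivative f t \<bullet> f' / norm (f t)) (at t)"
proof -
  have "(norm has_derivative (\<lambda>h. sgn (f t) \<bullet> h)) (at (f t))"
    using has_derivative_norm[OF \<open>f t \<noteq> 0\<close>] by (simp add: inner_commute)
  from diff_chain_at[OF f[unfolded has_vector_derivative_def] this]
  moreover have "(\<lambda>h. sgn (f t) \<bullet> h) \<circ> (\<lambda>h. h *\<^sub>R f') = (*) (f t \<bullet> f' / norm (f t))"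
    by (auto simp: fun_eq_iff sgn_div_norm divide_inverse)
  ultimately show ?thesis
    by (simp add: o_def has_field_derivative_def)
qed

text \<open>In polar form the velocity splits into a radial part and an angular part with
  coefficient \<open>n t * D\<close>. Pairing with \<open>perp (f t)\<close> kills the radial part,
  so \<open>D\<close> is determined by \<open>f\<close> and its derivative, whichever branch was
  chosen.\<close>

lemma angle_branch_deriv:
  assumes f: "(f has_vector_derivative f') (at t)" and ne: "f t \<noteq> 0"
    and br: "\<forall>\<^sub>F s in nhds t. is_angle_of (\<theta> s) (f s)"
    and \<theta>: "(\<theta> has_real_derivative D) (at t)"
  shows "D = (perp (f t) \<bullet> f') / (norm (f t))\<^sup>2"
proof -
  define n where "n = (\<lambda>s. norm (f s))"
  define n' where "n' = f t \<bullet> f' / norm (f t)"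
  have n: "(n has_real_derivative n') (at t)"
    unfolding n_def n'_def by (rule deriv_norm[OF f ne])
  have at: "is_angle_of (\<theta> t) (f t)"
    using br eventually_nhds_x_imp_x by blast
  have e1: "\<forall>\<^sub>F s in nhds t. f s $ 1 = n s * cos (\<theta> s)"
    using br by eventually_elim (simp add: is_angle_of_def n_def vector_eq_2)
  have e2: "\<forall>\<^sub>F s in nhds t. f s $ 2 = n s * sin (\<theta> s)"
    using br by eventually_elim (simp add: is_angle_of_def n_def vector_eq_2)
  have "((\<lambda>s. n s * cos (\<theta> s)) has_real_derivative f' $ 1) (at t)"
    using DERIV_cong_ev[OF refl e1 refl] has_vector_derivative_nth[OF f] by blast
  moreover have "((\<lambda>s. n s * cos (\<theta> s)) has_real_derivative
      n' * cos (\<theta> t) - n t * sin (\<theta> t) * D) (at t)"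
    by (auto intro!: derivative_eq_intros n \<theta>)
  ultimately have f1: "f' $ 1 = n' * cos (\<theta> t) - n t * sin (\<theta> t) * D"
    by (rule DERIV_unique)
  have "((\<lambda>s. n s * sin (\<theta> s)) has_real_derivative f' $ 2) (at t)"
    using DERIV_cong_ev[OF refl e2 refl] has_vector_derivative_nth[OF f] by blast
  moreover have "((\<lambda>s. n s * sin (\<theta> s)) has_real_derivative
      n' * sin (\<theta> t) + n t * cos (\<theta> t) * D) (at t)"
    by (auto intro!: derivative_eq_intros n \<theta>)
  ultimately have f2: "f' $ 2 = n' * sin (\<theta> t) + n t * cos (\<theta> t) * D"
    by (rule DERIV_unique)
  have ft: "f t $ 1 = n t * cos (\<theta> t)" "f t $ 2 = n t * sin (\<theta> t)"
    using at by (simp_all add: is_angle_of_def n_def vector_eq_2)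
  have "perp (f t) \<bullet> f' = (n t)\<^sup>2 * D * ((sin (\<theta> t))\<^sup>2 + (cos (\<theta> t))\<^sup>2)"
    unfolding inner_2 perp_nth f1 f2 ft
    by (simp add: algebra_simps power2_eq_square del: sin_cos_squared_add3)
  then show ?thesis
    using ne by (simp add: n_def)
qed

lemma is_angle_of_exists: "\<exists>\<theta>. is_angle_of \<theta> x"
proof (cases "x = 0")
  case False
  have "(norm x)\<^sup>2 = (x $ 1)\<^sup>2 + (x $ 2)\<^sup>2"
    by (simp add: norm_2)
  then have "(x $ 1 / norm x)\<^sup>2 + (x $ 2 / norm x)\<^sup>2 = (norm x)\<^sup>2 / (norm x)\<^sup>2"
    by (simp only: power_divide add_divide_distrib)
  with False have "(x $ 1 / norm x)\<^sup>2 + (x $ 2 / norm x)\<^sup>2 = 1" by simp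
  then obtain \<theta> where "x $ 1 / norm x = cos \<theta>" "x $ 2 / norm x = sin \<theta>"
    by (rule sincos_total_2pi)
  with False have "norm x * cos \<theta> = x $ 1" "norm x * sin \<theta> = x $ 2"
    by (metis nonzero_mult_div_cancel_left norm_eq_zero times_divide_eq_right)+
  then have "is_angle_of \<theta> x"
    by (simp add: is_angle_of_def vector_eq_2)
  then show ?thesis ..
qed (simp add: is_angle_of_def)

text \<open>Read in the complex plane, \<open>x \<bullet> y\<close> and
  \<open>perp x \<bullet> y\<close> are the real and imaginary part of y times the conjugate of x.
  In the half-plane around x the arctangent of their quotient is the angle from x to y; this gives a
  smooth branch near any nonzero point, without a cut.\<close>

lemma is_angle_of_add_arctan:
  assumes \<theta>: "is_angle_of \<theta> x" and pos: "x \<bullet> y > 0"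
  shows "is_angle_of (\<theta> + arctan ((perp x \<bullet> y) / (x \<bullet> y))) y"
proof -
  define A where "A = x \<bullet> y"
  define B where "B = perp x \<bullet> y"
  have n0: "norm x > 0" "norm y > 0" using pos by auto
  have A: "A > 0" using pos by (simp add: A_def)
  \<comment> \<open>Lagrange's identity.\<close>
  have AB: "A\<^sup>2 + B\<^sup>2 = (norm x * norm y)\<^sup>2"
    unfolding A_def B_def power_mult_distrib power2_norm_eq_inner inner_2 perp_nth
    by (simp add: power2_eq_square algebra_simps)
  have "sqrt (1 + (B / A)\<^sup>2) = sqrt ((A\<^sup>2 + B\<^sup>2) / A\<^sup>2)"
    using A by (simp add: power_divide add_divide_distrib)
  also have "\<dots> = norm x * norm y / A"
    using A n0 unfolding AB by (simp add: real_sqrt_divide)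
  finally have sq: "sqrt (1 + (B / A)\<^sup>2) = norm x * norm y / A" .
  have c: "cos (arctan (B / A)) = A / (norm x * norm y)"
    and s: "sin (arctan (B / A)) = B / (norm x * norm y)"
    using A n0 unfolding cos_arctan sin_arctan sq by simp_all
  have x: "x $ 1 = norm x * cos \<theta>" "x $ 2 = norm x * sin \<theta>"
    using \<theta> by (simp_all add: is_angle_of_def vector_eq_2)
  have ct: "cos \<theta> = x $ 1 / norm x" and st: "sin \<theta> = x $ 2 / norm x"
    using n0(1) unfolding x by simp_all
  have nx: "x $ 1 * x $ 1 + x $ 2 * x $ 2 = norm x * norm x"
    by (simp add: norm_2 flip: power2_eq_square)
  have "norm y * cos (\<theta> + arctan (B / A)) = (x $ 1 * A - x $ 2 * B) / (norm x * norm x)"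
    using n0(2) by (simp add: cos_add c s ct st diff_divide_distrib right_diff_distrib)
  also have "x $ 1 * A - x $ 2 * B = (x $ 1 * x $ 1 + x $ 2 * x $ 2) * y $ 1"
    by (simp add: A_def B_def inner_2 algebra_simps)
  finally have 1: "norm y * cos (\<theta> + arctan (B / A)) = y $ 1" using n0 by (simp add: nx)
  have "norm y * sin (\<theta> + arctan (B / A)) = (x $ 2 * A + x $ 1 * B) / (norm x * norm x)"
    using n0(2) by (simp add: sin_add c s ct st add_divide_distrib distrib_left)
  also have "x $ 2 * A + x $ 1 * B = (x $ 1 * x $ 1 + x $ 2 * x $ 2) * y $ 2"
    by (simp add: A_def B_def inner_2 algebra_simps)
  finally have 2: "norm y * sin (\<theta> + arctan (B / A)) = y $ 2" using n0 by (simp add: nx)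
  show ?thesis
    using 1 2 by (simp add: is_angle_of_def vector_eq_2 A_def B_def)
qed

text \<open>The arctangent branch anchored at \<open>f t\<close> provides existence,
  \<open>angle_branch_deriv\<close> the value and its uniqueness, so the description in
  \<open>angle_deriv\<close> denotes.\<close>

lemma angle_deriv_eq:
  assumes f: "(f has_vector_derivative f') (at t)" and ne: "f t \<noteq> 0"
  shows "angle_deriv f t = (perp (f t) \<bullet> f') / (norm (f t))\<^sup>2"
proof -
  obtain \<theta>0 where \<theta>0: "is_angle_of \<theta>0 (f t)" using is_angle_of_exists by blast
  define \<theta> where "\<theta> = (\<lambda>s. \<theta>0 + arctan ((perp (f t) \<bullet> f s) / (f t \<bullet> f s)))"
  have cont: "continuous (at t) f"
    using f by (rule has_vector_derivative_continuous)
  have "((\<lambda>s. f t \<bullet> f s) \<longlongrightarrow> f t \<bullet> f t) (nhds t)"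
    using cont unfolding continuous_at by (auto intro!: tendsto_intros simp: tendsto_at_iff_tendsto_nhds)
  then have "\<forall>\<^sub>F s in nhds t. f t \<bullet> f s > 0"
    using ne by (intro order_tendstoD(1)[where y = "f t \<bullet> f t"]) auto
  then have br: "\<forall>\<^sub>F s in nhds t. is_angle_of (\<theta> s) (f s)"
    by eventually_elim (simp add: \<theta>_def is_angle_of_add_arctan \<theta>0)
  have inn: "((\<lambda>s. z \<bullet> f s) has_real_derivative z \<bullet> f') (at t)" for z
    using bounded_linear.has_vector_derivative[OF bounded_linear_inner_right f, of z]
    by (simp add: has_real_derivative_iff_has_vector_derivative)
  \<comment> \<open>Differentiability alone suffices here; the value follows from
    \<open>angle_branch_deriv\<close>.\<close>
  have "\<exists>D. (\<theta> has_real_derivative D) (at t)"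
    unfolding \<theta>_def using ne
    by (intro exI) (rule derivative_eq_intros inn refl | simp)+
  then obtain D where D: "(\<theta> has_real_derivative D) (at t)" ..
  show ?thesis
    unfolding angle_deriv_def
  proof (rule the_equality)
    show "\<exists>\<theta>. (\<forall>\<^sub>F s in nhds t. is_angle_of (\<theta> s) (f s)) \<and>
        (\<theta> has_real_derivative (perp (f t) \<bullet> f') / (norm (f t))\<^sup>2) (at t)"
      using br D angle_branch_deriv[OF f ne br D] by blast
  next
    fix D assume "\<exists>\<theta>. (\<forall>\<^sub>F s in nhds t. is_angle_of (\<theta> s) (f s)) \<and>
        (\<theta> has_real_derivative D) (at t)"
    then show "D = (perp (f t) \<bullet> f') / (norm (f t))\<^sup>2"
      using angle_branch_deriv[OF f ne] by blast
  qed
qed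

text \<open>The cosine has to exclude the origin: \<open>Arg 0 = 0\<close> has cosine 1 there, while
  the quotient is 0 by the convention on division.\<close>

lemma cos_polar_angle: "x \<noteq> 0 \<Longrightarrow> cos (polar_angle x) = x $ 1 / norm x"
  and sin_polar_angle: "sin (polar_angle x) = x $ 2 / norm x"
proof -
  have n: "cmod (Complex (x $ 1) (x $ 2)) = norm x"
    by (simp add: norm_2 cmod_def)
  have z: "Complex (x $ 1) (x $ 2) = 0 \<longleftrightarrow> x = 0"
    by (simp add: vector_eq_2 complex_eq_iff)
  show "cos (polar_angle x) = x $ 1 / norm x" if "x \<noteq> 0"
    using that by (simp add: polar_angle_def cos_Arg n z)
  show "sin (polar_angle x) = x $ 2 / norm x"
    by (cases "x = 0") (simp_all add: polar_angle_def sin_Arg n z Arg_zero flip: zero_complex.code)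
qed

section \<open>Derivatives in the parameters\<close>

text \<open>The contour without its centre and the tangent are the same expression in the
  parameters, with the basis functions in one case and their derivatives in the other. One
  computation of parameter derivatives serves both.\<close>

definition shape :: "nat \<Rightarrow> (nat \<Rightarrow> real) \<Rightarrow> (nat \<Rightarrow> real) \<Rightarrow> (nat \<Rightarrow> real) \<Rightarrow> real^2"
  where "shape Q f g \<gamma> = rot (\<gamma> 3) *v
    vector [\<Sum>k=1..Q. f k * acoef \<gamma> k, \<Sum>k=1..Q. g k * bcoef Q \<gamma> k]"

definition shape_deriv ::
  "nat \<Rightarrow> (nat \<Rightarrow> real) \<Rightarrow> (nat \<Rightarrow> real) \<Rightarrow> (nat \<Rightarrow> real) \<Rightarrow> nat \<Rightarrow> real^2"
  where "shape_deriv Q f g \<gamma> i =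
    (if i \<le> 2 then 0 else if i = 3 then perp (shape Q f g \<gamma>)
     else rot (\<gamma> 3) *v (if i \<le> 3 + Q then vector [f (i - 3), 0] else vector [0, g (i - 3 - Q)]))"

definition centre_deriv :: "(nat \<Rightarrow> real) \<Rightarrow> nat \<Rightarrow> real^2"
  where "centre_deriv \<gamma> i =
    (if i = 1 then vector [cos (\<gamma> 2), sin (\<gamma> 2)] else if i = 2 then perp (centre \<gamma>) else 0)"

definition dsigma :: "nat \<Rightarrow> real \<Rightarrow> real"
  where "dsigma k u = - real k * sin (real k * u)"

definition dvarsigma :: "nat \<Rightarrow> real \<Rightarrow> real"
  where "dvarsigma k u = real k * cos (real k * u)"

lemma sigma_deriv: "(sigma k has_real_derivative dsigma k u) (at u)"
  and varsigma_deriv: "(varsigma k has_real_derivative dvarsigma k u) (at u)"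
  unfolding sigma_def[abs_def] varsigma_def[abs_def] dsigma_def dvarsigma_def
  by (auto intro!: derivative_eq_intros)

definition drho :: "nat \<Rightarrow> (nat \<Rightarrow> real) \<Rightarrow> (nat \<Rightarrow> real) \<Rightarrow> real \<Rightarrow> real^2"
  where "drho Q a b u = vector [\<Sum>k=1..Q. dsigma k u * a k, \<Sum>k=1..Q. dvarsigma k u * b k]"

lemma rho_deriv: "(rho Q a b has_vector_derivative drho Q a b u) (at u)"
  unfolding rho_def[abs_def] drho_def
  by (intro has_vector_derivative_vector_2) (auto intro!: derivative_eq_intros sigma_deriv varsigma_deriv)

lemma vector_derivative_rho: "vector_derivative (rho Q a b) (at u) = drho Q a b u"
  by (rule vector_derivative_at[OF rho_deriv])

lemma contour_eq_shape:
  "contour Q \<gamma> u = centre \<gamma> + shape Q (\<lambda>k. sigma k u) (\<lambda>k. varsigma k u) \<gamma>"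
  by (simp add: contour_def shape_def rho_def)

lemma contour_deriv:
  "(contour Q \<gamma> has_vector_derivative rot (\<gamma> 3) *v drho Q (acoef \<gamma>) (bcoef Q \<gamma>) u) (at u)"
  unfolding contour_def[abs_def]
  using bounded_linear.has_vector_derivative[OF matrix_vector_mul_bounded_linear rho_deriv]
  by (auto intro!: derivative_eq_intros)

lemma tangent_eq: "tangent Q \<gamma> u = rot (\<gamma> 3) *v drho Q (acoef \<gamma>) (bcoef Q \<gamma>) u"
  unfolding tangent_def by (rule vector_derivative_at[OF contour_deriv])

lemma tangent_eq_shape:
  "tangent Q \<gamma> u = shape Q (\<lambda>k. dsigma k u) (\<lambda>k. dvarsigma k u) \<gamma>"
  by (simp add: tangent_eq shape_def drho_def)

lemma fun_upd_deriv:
  "((\<lambda>x. (\<gamma>(i := x)) j) has_real_derivative of_bool (j = i)) (at t)"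
  for \<gamma> :: "nat \<Rightarrow> real"
  by (cases "j = i") auto

text \<open>The offset \<open>n\<close> locates a block of the parameter vector: 3 for the
  coefficients of the cosines, \<open>3 + Q\<close> for those of the sines.\<close>

lemma sum_fun_upd_deriv:
  "((\<lambda>x. \<Sum>k=1..Q. f k * (\<gamma>(i := x)) (n + k)) has_real_derivative
     (if n < i \<and> i \<le> n + Q then f (i - n) else 0)) (at t)"
  for \<gamma> f :: "nat \<Rightarrow> real"
proof -
  have "((\<lambda>x. \<Sum>k=1..Q. f k * (\<gamma>(i := x)) (n + k)) has_real_derivative
     (\<Sum>k=1..Q. f k * of_bool (n + k = i))) (at t)"
    by (intro DERIV_sum DERIV_cmult fun_upd_deriv)
  also have "(\<Sum>k=1..Q. f k * of_bool (n + k = i)) =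
      (\<Sum>k=1..Q. if k = i - n then f k * of_bool (n < i) else 0)"
    by (intro sum.cong) auto
  also have "\<dots> = (if n < i \<and> i \<le> n + Q then f (i - n) else 0)"
    by (subst sum.delta) auto
  finally show ?thesis .
qed

text \<open>The product rule, given that the derivative of a rotation in its angle is the rotation
  followed by a quarter turn.\<close>

lemma rot_mult_deriv:
  assumes "(\<psi> has_real_derivative \<psi>') (at t)"
    "(f has_real_derivative f') (at t)" "(g has_real_derivative g') (at t)"
  shows "((\<lambda>x. rot (\<psi> x) *v vector [f x, g x]) has_vector_derivative
     (\<psi>' *\<^sub>R perp (rot (\<psi> t) *v vector [f t, g t]) + rot (\<psi> t) *v vector [f', g'])) (at t)"
proof -
  have eq: "rot p *v vector [x, y] = vector [cos p * x - sin p * y, sin p * x + cos p * y]" for p x y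
    by (simp add: vector_eq_2)
  have "((\<lambda>x. rot (\<psi> x) *v vector [f x, g x]) has_vector_derivative
     vector [cos (\<psi> t) * f' - sin (\<psi> t) * \<psi>' * f t - (sin (\<psi> t) * g' + cos (\<psi> t) * \<psi>' * g t),
       sin (\<psi> t) * f' + cos (\<psi> t) * \<psi>' * f t + (cos (\<psi> t) * g' - sin (\<psi> t) * \<psi>' * g t)]) (at t)"
    unfolding eq using assms
    by (intro has_vector_derivative_vector_2) (auto intro!: derivative_eq_intros)
  then show ?thesis
    by (rule back_subst[of "\<lambda>z. (_ has_vector_derivative z) _"]) (simp add: vector_eq_2 algebra_simps)
qed

text \<open>Beyond index \<open>2 * Q + 3\<close> the shape is constant in the parameter, while the
  last case of \<open>shape_deriv\<close> would still return a value of \<open>g\<close>; hence the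
  range of \<open>i\<close>.\<close>

lemma shape_has_deriv:
  assumes i: "i \<in> {1..2 * Q + 3}"
  shows "((\<lambda>x. shape Q f g (\<gamma>(i := x))) has_vector_derivative shape_deriv Q f g \<gamma> i) (at (\<gamma> i))"
proof -
  have "((\<lambda>x. shape Q f g (\<gamma>(i := x))) has_vector_derivative
     (of_bool (3 = i) *\<^sub>R perp (rot ((\<gamma>(i := \<gamma> i)) 3) *v vector
        [\<Sum>k=1..Q. f k * (\<gamma>(i := \<gamma> i)) (3 + k), \<Sum>k=1..Q. g k * (\<gamma>(i := \<gamma> i)) (3 + Q + k)])
      + rot ((\<gamma>(i := \<gamma> i)) 3) *v vector [if 3 < i \<and> i \<le> 3 + Q then f (i - 3) else 0,
          if 3 + Q < i \<and> i \<le> 3 + Q + Q then g (i - (3 + Q)) else 0])) (at (\<gamma> i))"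
    unfolding shape_def acoef_def bcoef_def
    by (intro rot_mult_deriv fun_upd_deriv sum_fun_upd_deriv)
  then show ?thesis
    by (rule back_subst[of "\<lambda>z. (_ has_vector_derivative z) _"])
      (use i in \<open>auto simp: shape_deriv_def shape_def acoef_def bcoef_def vector_eq_2\<close>)
qed

lemma centre_has_deriv:
  "((\<lambda>x. centre (\<gamma>(i := x))) has_vector_derivative centre_deriv \<gamma> i) (at (\<gamma> i))"
proof -
  have eq: "centre \<gamma> = vector [\<gamma> 1 * cos (\<gamma> 2), \<gamma> 1 * sin (\<gamma> 2)]" for \<gamma>
    by (simp add: centre_def vector_eq_2)
  have "((\<lambda>x. centre (\<gamma>(i := x))) has_vector_derivative
     vector [of_bool (1 = i) * cos (\<gamma> 2) - \<gamma> 1 * (sin (\<gamma> 2) * of_bool (2 = i)),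
       of_bool (1 = i) * sin (\<gamma> 2) + \<gamma> 1 * (cos (\<gamma> 2) * of_bool (2 = i))]) (at (\<gamma> i))"
    unfolding eq
    by (intro has_vector_derivative_vector_2) (auto intro!: derivative_eq_intros fun_upd_deriv)
  then show ?thesis
    by (rule back_subst[of "\<lambda>z. (_ has_vector_derivative z) _"])
      (simp add: centre_deriv_def vector_eq_2 centre_def)
qed

lemma contour_param_deriv:
  assumes "i \<in> {1..2 * Q + 3}"
  shows "((\<lambda>x. contour Q (\<gamma>(i := x)) u) has_vector_derivative
    (centre_deriv \<gamma> i + shape_deriv Q (\<lambda>k. sigma k u) (\<lambda>k. varsigma k u) \<gamma> i)) (at (\<gamma> i))"
  unfolding contour_eq_shape
  by (intro has_vector_derivative_add centre_has_deriv shape_has_deriv assms)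

lemma tangent_param_deriv:
  assumes "i \<in> {1..2 * Q + 3}"
  shows "((\<lambda>x. tangent Q (\<gamma>(i := x)) u) has_vector_derivative
    shape_deriv Q (\<lambda>k. dsigma k u) (\<lambda>k. dvarsigma k u) \<gamma> i) (at (\<gamma> i))"
  unfolding tangent_eq_shape by (intro shape_has_deriv assms)

section \<open>Continuity and bounds on the whole line, and the angle between two vectors\<close>

lemma continuous_on_vector_2 [continuous_intros]:
  assumes "continuous_on S f" "continuous_on S g"
  shows "continuous_on S (\<lambda>x. vector [f x, g x] :: real^2)"
proof -
  have eq: "vector [s, t] = s *\<^sub>R (vector [1, 0] :: real^2) + t *\<^sub>R vector [0, 1]" for s t
    by (simp add: vector_eq_2)
  show ?thesis
    unfolding eq[of "f _" "g _"] by (intro continuous_intros assms)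
qed

lemma continuous_on_rot_mult [continuous_intros]:
  assumes "continuous_on S f"
  shows "continuous_on S (\<lambda>x. rot \<psi> *v f x)"
  using bounded_linear.continuous_on[OF matrix_vector_mul_bounded_linear assms] .

lemma continuous_on_perp [continuous_intros]:
  assumes "continuous_on S f"
  shows "continuous_on S (\<lambda>x. perp (f x))"
  unfolding perp_def using bounded_linear.continuous_on[OF matrix_vector_mul_bounded_linear assms] .

lemma continuous_on_trig_basis [continuous_intros]:
  "continuous_on S (sigma k)" "continuous_on S (varsigma k)"
  "continuous_on S (dsigma k)" "continuous_on S (dvarsigma k)"
  unfolding sigma_def[abs_def] varsigma_def[abs_def] dsigma_def[abs_def] dvarsigma_def[abs_def]
  by (intro continuous_intros)+

lemma abs_trig_basis_le:
  "\<bar>sigma k u\<bar> \<le> 1" "\<bar>varsigma k u\<bar> \<le> 1" "\<bar>dsigma k u\<bar> \<le> real k" "\<bar>dvarsigma k u\<bar> \<le> real k"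
  by (simp_all add: sigma_def varsigma_def dsigma_def dvarsigma_def abs_mult mult_left_le)

lemma continuous_on_shape [continuous_intros]:
  assumes "\<And>k. continuous_on S (f k)" "\<And>k. continuous_on S (g k)"
  shows "continuous_on S (\<lambda>u. shape Q (\<lambda>k. f k u) (\<lambda>k. g k u) \<gamma>)"
  unfolding shape_def by (intro continuous_intros assms)

lemma continuous_on_shape_deriv [continuous_intros]:
  assumes "\<And>k. continuous_on S (f k)" "\<And>k. continuous_on S (g k)"
  shows "continuous_on S (\<lambda>u. shape_deriv Q (\<lambda>k. f k u) (\<lambda>k. g k u) \<gamma> i)"
proof (cases "i \<le> 3")
  case True
  then show ?thesis
    unfolding shape_deriv_def by (cases "i = 3") (auto intro!: continuous_intros assms)
next
  case False
  then show ?thesis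
    unfolding shape_deriv_def by (cases "i \<le> 3 + Q") (auto intro!: continuous_intros assms)
qed

lemma norm_shape_le:
  assumes "\<And>k. \<bar>f k\<bar> \<le> h k" "\<And>k. \<bar>g k\<bar> \<le> h k"
  shows "norm (shape Q f g \<gamma>)
    \<le> (\<Sum>k=1..Q. h k * \<bar>acoef \<gamma> k\<bar>) + (\<Sum>k=1..Q. h k * \<bar>bcoef Q \<gamma> k\<bar>)"
proof -
  have "\<bar>\<Sum>k=1..Q. f k * acoef \<gamma> k\<bar> \<le> (\<Sum>k=1..Q. h k * \<bar>acoef \<gamma> k\<bar>)"
    by (rule order_trans[OF sum_abs]) (auto intro!: sum_mono mult_right_mono assms simp: abs_mult)
  moreover have "\<bar>\<Sum>k=1..Q. g k * bcoef Q \<gamma> k\<bar> \<le> (\<Sum>k=1..Q. h k * \<bar>bcoef Q \<gamma> k\<bar>)"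
    by (rule order_trans[OF sum_abs]) (auto intro!: sum_mono mult_right_mono assms simp: abs_mult)
  ultimately show ?thesis
    unfolding shape_def norm_rot by (intro order_trans[OF norm_vector_2_le] add_mono)
qed

lemma norm_shape_deriv_le:
  "norm (shape_deriv Q f g \<gamma> i) \<le> norm (shape Q f g \<gamma>) + \<bar>f (i - 3)\<bar> + \<bar>g (i - 3 - Q)\<bar>"
proof -
  have "norm (vector [x, 0] :: real^2) = \<bar>x\<bar>" "norm (vector [0, x] :: real^2) = \<bar>x\<bar>" for x
    by (simp_all add: norm_2)
  then show ?thesis
    by (auto simp: shape_deriv_def add_nonneg_nonneg)
qed

lemma uniform_limit_bound:
  fixes f :: "'i \<Rightarrow> 'a \<Rightarrow> 'b::metric_space"
  assumes "\<forall>\<^sub>F d in F. \<forall>u\<in>S. dist (f d u) (l u) \<le> g d" "(g \<longlongrightarrow> (0::real)) F"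
  shows "uniform_limit S f l F"
proof (rule uniform_limitI)
  fix e :: real assume "e > 0"
  then have "\<forall>\<^sub>F d in F. g d < e" using assms(2) by (rule order_tendstoD(2)[rotated])
  with assms(1) show "\<forall>\<^sub>F d in F. \<forall>u\<in>S. dist (f d u) (l u) < e"
    by eventually_elim force
qed

text \<open>For unit vectors \<open>perp x \<bullet> y\<close> is the sine of the angle from x to y,
  that is of the second angle minus the first; hence the sign.\<close>

lemma sin_polar_angle_diff:
  "x \<noteq> 0 \<Longrightarrow> y \<noteq> 0 \<Longrightarrow> sin (polar_angle x - polar_angle y) = - (perp (sgn x) \<bullet> sgn y)"
  and cos_polar_angle_diff:
  "x \<noteq> 0 \<Longrightarrow> y \<noteq> 0 \<Longrightarrow> cos (polar_angle x - polar_angle y) = sgn x \<bullet> sgn y"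
  by (simp_all add: sin_diff cos_diff cos_polar_angle sin_polar_angle inner_2 sgn_div_norm divide_inverse mult_ac)

section \<open>Bounded families of functions\<close>

text \<open>Everything is required only eventually, since for small d the contour may pass through
  the origin, where distance and angles are not smooth. Measurability is included because bounded
  measurable functions can be integrated over the period, so that integrals may be
  subtracted.\<close>

definition bounded_family :: "(real \<Rightarrow> real \<Rightarrow> real) \<Rightarrow> bool"
  where "bounded_family F \<longleftrightarrow>
    (\<exists>K. \<forall>\<^sub>F d in at_top. F d \<in> borel_measurable borel \<and> (\<forall>u. \<bar>F d u\<bar> \<le> K))"

text \<open>Neither family need converge. Boundedness of both is part of the notion, so that it is
  preserved by products.\<close>

definition close :: "(real \<Rightarrow> real \<Rightarrow> real) \<Rightarrow> (real \<Rightarrow> real \<Rightarrow> real) \<Rightarrow> bool"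
  where "close F G \<longleftrightarrow> bounded_family F \<and> bounded_family G
    \<and> uniform_limit UNIV (\<lambda>d u. F d u - G d u) (\<lambda>_. 0) at_top"

lemma bounded_familyI:
  "\<forall>\<^sub>F d in at_top. F d \<in> borel_measurable borel \<Longrightarrow> \<forall>\<^sub>F d in at_top. \<forall>u. \<bar>F d u\<bar> \<le> K
    \<Longrightarrow> bounded_family F"
  unfolding bounded_family_def by (auto intro!: exI[of _ K] eventually_conj)

lemma bounded_familyE:
  assumes "bounded_family F"
  obtains K where "K > 0" "\<forall>\<^sub>F d in at_top. F d \<in> borel_measurable borel"
    "\<forall>\<^sub>F d in at_top. \<forall>u. \<bar>F d u\<bar> \<le> K"
proof -
  obtain K where K: "\<forall>\<^sub>F d in at_top. F d \<in> borel_measurable borel \<and> (\<forall>u. \<bar>F d u\<bar> \<le> K)"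
    using assms unfolding bounded_family_def ..
  show thesis
  proof (rule that[of "\<bar>K\<bar> + 1"])
    show "\<forall>\<^sub>F d in at_top. \<forall>u. \<bar>F d u\<bar> \<le> \<bar>K\<bar> + 1"
      using K proof eventually_elim
    case (elim d)
    show ?case
    proof
      fix u show "\<bar>F d u\<bar> \<le> \<bar>K\<bar> + 1"
        using conjunct2[OF elim, THEN spec, of u] by linarith
    qed
  qed
  qed (use K in \<open>auto elim: eventually_mono\<close>)
qed

lemma bounded_family_mult:
  assumes "bounded_family F" "bounded_family G"
  shows "bounded_family (\<lambda>d u. F d u * G d u)"
proof -
  obtain K where K: "K > 0" "\<forall>\<^sub>F d in at_top. F d \<in> borel_measurable borel"
      "\<forall>\<^sub>F d in at_top. \<forall>u. \<bar>F d u\<bar> \<le> K" by (rule bounded_familyE[OF assms(1)])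
  obtain H where H: "H > 0" "\<forall>\<^sub>F d in at_top. G d \<in> borel_measurable borel"
      "\<forall>\<^sub>F d in at_top. \<forall>u. \<bar>G d u\<bar> \<le> H" by (rule bounded_familyE[OF assms(2)])
  show ?thesis
  proof (rule bounded_familyI)
    show "\<forall>\<^sub>F d in at_top. (\<lambda>u. F d u * G d u) \<in> borel_measurable borel"
      using K(2) H(2) by eventually_elim simp
    show "\<forall>\<^sub>F d in at_top. \<forall>u. \<bar>F d u * G d u\<bar> \<le> K * H"
      using K(3) H(3) by eventually_elim (use K(1) in \<open>auto simp: abs_mult intro!: mult_mono\<close>)
  qed
qed

lemma bounded_family_diff:
  assumes "bounded_family F" "bounded_family G"
  shows "bounded_family (\<lambda>d u. F d u - G d u)"
proof -
  obtain K where K: "K > 0" "\<forall>\<^sub>F d in at_top. F d \<in> borel_measurable borel"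
      "\<forall>\<^sub>F d in at_top. \<forall>u. \<bar>F d u\<bar> \<le> K" by (rule bounded_familyE[OF assms(1)])
  obtain H where H: "H > 0" "\<forall>\<^sub>F d in at_top. G d \<in> borel_measurable borel"
      "\<forall>\<^sub>F d in at_top. \<forall>u. \<bar>G d u\<bar> \<le> H" by (rule bounded_familyE[OF assms(2)])
  show ?thesis
  proof (rule bounded_familyI)
    show "\<forall>\<^sub>F d in at_top. (\<lambda>u. F d u - G d u) \<in> borel_measurable borel"
      using K(2) H(2) by eventually_elim simp
    show "\<forall>\<^sub>F d in at_top. \<forall>u. \<bar>F d u - G d u\<bar> \<le> K + H"
      using K(3) H(3) proof eventually_elim
    case (elim d)
    show ?case
    proof
      fix u show "\<bar>F d u - G d u\<bar> \<le> K + H"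
        using spec[OF elim(1), of u] spec[OF elim(2), of u] by linarith
    qed
  qed
  qed
qed

lemma bounded_family_const:
  "\<forall>\<^sub>F d in at_top. \<bar>c d\<bar> \<le> K \<Longrightarrow> bounded_family (\<lambda>d u. c d)"
  by (rule bounded_familyI[where K = K]) auto

lemma close_bounded: "close F G \<Longrightarrow> bounded_family F" "close F G \<Longrightarrow> bounded_family G"
  by (simp_all add: close_def)

text \<open>The entry point for genuine limits: a uniform distance below 1 eventually hands the
  bound of \<open>G\<close> on to \<open>F\<close>.\<close>

lemma close_limit:
  assumes lim: "uniform_limit UNIV F G at_top"
    and F: "\<forall>\<^sub>F d in at_top. F d \<in> borel_measurable borel"
    and G: "G \<in> borel_measurable borel" "\<exists>K. \<forall>u. \<bar>G u\<bar> \<le> K"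
  shows "close F (\<lambda>d. G)"
  unfolding close_def
proof (intro conjI)
  obtain K where K: "\<And>u. \<bar>G u\<bar> \<le> K" using G(2) by blast
  show "bounded_family (\<lambda>d. G)" by (rule bounded_familyI[where K = K]) (auto simp: G(1) K)
  have "\<forall>\<^sub>F d in at_top. \<forall>u\<in>UNIV. dist (F d u) (G u) < 1"
    using lim by (rule uniform_limitD) simp
  then have "\<forall>\<^sub>F d in at_top. \<forall>u. \<bar>F d u\<bar> \<le> K + 1"
  proof eventually_elim
    case (elim d)
    show ?case
    proof
      fix u show "\<bar>F d u\<bar> \<le> K + 1"
        using bspec[OF elim UNIV_I, of u] K[of u] by (simp add: dist_real_def)
    qed
  qed
  then show "bounded_family F" by (rule bounded_familyI[OF F])
  show "uniform_limit UNIV (\<lambda>d u. F d u - G u) (\<lambda>_. 0) at_top"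
    using lim by (simp add: uniform_limit_iff dist_real_def)
qed

lemma close_mult_left:
  assumes H: "bounded_family H" and FG: "close F G"
  shows "close (\<lambda>d u. H d u * F d u) (\<lambda>d u. H d u * G d u)"
  unfolding close_def
proof (intro conjI)
  show "bounded_family (\<lambda>d u. H d u * F d u)" "bounded_family (\<lambda>d u. H d u * G d u)"
    using assms by (auto intro!: bounded_family_mult simp: close_def)
  obtain K where K: "K > 0" "\<forall>\<^sub>F d in at_top. \<forall>u. \<bar>H d u\<bar> \<le> K"
    using bounded_familyE[OF H] by metis
  show "uniform_limit UNIV (\<lambda>d u. H d u * F d u - H d u * G d u) (\<lambda>_. 0) at_top"
  proof (rule uniform_limitI)
    fix e :: real assume "e > 0"
    then have "\<forall>\<^sub>F d in at_top. \<forall>u\<in>UNIV. dist (F d u - G d u) 0 < e / K"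
      using FG K(1) unfolding close_def by (intro uniform_limitD) auto
    then show "\<forall>\<^sub>F d in at_top. \<forall>u\<in>UNIV. dist (H d u * F d u - H d u * G d u) 0 < e"
      using K(2)
    proof eventually_elim
      fix d assume le: "\<forall>u\<in>UNIV. dist (F d u - G d u) 0 < e / K" "\<forall>u. \<bar>H d u\<bar> \<le> K"
      have "\<bar>H d u\<bar> * \<bar>F d u - G d u\<bar> < e" for u
      proof -
        have "\<bar>H d u\<bar> * \<bar>F d u - G d u\<bar> \<le> K * \<bar>F d u - G d u\<bar>"
          using le(2) by (intro mult_right_mono) auto
        also have "\<dots> < K * (e / K)"
          using le(1) K(1) by (intro mult_strict_left_mono) auto
        finally show ?thesis using K(1) by simp
      qed
      then show "\<forall>u\<in>UNIV. dist (H d u * F d u - H d u * G d u) 0 < e"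
        by (simp add: right_diff_distrib[symmetric] abs_mult)
    qed
  qed
qed

lemma close_trans:
  assumes "close F G" "close G H" shows "close F H"
proof -
  have "uniform_limit UNIV (\<lambda>d u. (F d u - G d u) + (G d u - H d u)) (\<lambda>_. 0 + 0) at_top"
    using assms unfolding close_def by (intro uniform_limit_add) auto
  then show ?thesis using assms by (simp add: close_def)
qed

text \<open>One factor is exchanged at a time, while the other one is merely bounded.\<close>

lemma close_mult:
  assumes "close F F'" "close G G'"
  shows "close (\<lambda>d u. F d u * G d u) (\<lambda>d u. F' d u * G' d u)"
proof (rule close_trans)
  show "close (\<lambda>d u. F d u * G d u) (\<lambda>d u. F d u * G' d u)"
    by (intro close_mult_left close_bounded(1)[OF assms(1)] assms(2))
  show "close (\<lambda>d u. F d u * G' d u) (\<lambda>d u. F' d u * G' d u)"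
    using close_mult_left[OF close_bounded(2)[OF assms(2)] assms(1)] by (simp add: mult.commute)
qed

lemma close_diff:
  assumes "close F F'" "close G G'"
  shows "close (\<lambda>d u. F d u - G d u) (\<lambda>d u. F' d u - G' d u)"
  unfolding close_def
proof (intro conjI)
  have "uniform_limit UNIV (\<lambda>d u. (F d u - F' d u) - (G d u - G' d u)) (\<lambda>_. 0 - 0) at_top"
    using assms unfolding close_def by (intro uniform_limit_intros) auto
  then show "uniform_limit UNIV (\<lambda>d u. (F d u - G d u) - (F' d u - G' d u)) (\<lambda>_. 0) at_top"
    by (simp add: algebra_simps)
qed (use assms in \<open>auto intro!: bounded_family_diff simp: close_def\<close>)

lemma close_refl: "bounded_family F \<Longrightarrow> close F F"
  by (simp add: close_def uniform_limit_const)

section \<open>Integrals of bounded functions over an interval\<close>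

lemma set_integrable_bounded:
  fixes f :: "real \<Rightarrow> real"
  assumes "f \<in> borel_measurable borel" "\<And>u. \<bar>f u\<bar> \<le> K"
  shows "set_integrable lborel {x..y} f"
  unfolding set_integrable_def
  by (rule integrableI_bounded_set_indicator[where B = K]) (use assms in \<open>auto simp: emeasure_lborel_Icc_eq\<close>)

lemma abs_set_integral_le:
  fixes f :: "real \<Rightarrow> real"
  assumes "f \<in> borel_measurable borel" "\<And>u. \<bar>f u\<bar> \<le> K"  "x \<le> y"
  shows "\<bar>set_lebesgue_integral lborel {x..y} f\<bar> \<le> K * (y - x)"
proof -
  have "norm (set_lebesgue_integral lborel {x..y} f) \<le> (LINT u:{x..y}|lborel. norm (f u))"
    by (rule set_integral_norm_bound[OF set_integrable_bounded[OF assms(1,2)]])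
  also have "\<dots> \<le> (LINT u:{x..y}|lborel. K)"
    by (intro set_integral_mono set_integrable_bounded[where K = "\<bar>K\<bar>"])
      (use assms in \<open>auto intro: order_trans[OF _ abs_ge_self]\<close>)
  also have "\<dots> = K * (y - x)"
    using assms(3) by (simp add: set_lebesgue_integral_def)
  finally show ?thesis by simp
qed

text \<open>\<open>K\<close> will bound the size of the contour, so that \<open>d - K\<close> is a
  lower bound for the distance of all its points.\<close>

lemma tendsto_inverse_shift: "((\<lambda>d. inverse (d - K)) \<longlongrightarrow> 0) at_top" for K :: real
  using tendsto_inverse_0_at_top[OF filterlim_tendsto_add_at_top[OF tendsto_const[of "-K"] filterlim_ident]]
  by simp

section \<open>The contour with all parameters fixed except the distance\<close>

locale far_contour =
  fixes Q :: nat and \<phi>0 \<psi> :: real and a b :: "nat \<Rightarrow> real" and \<alpha> :: real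
  assumes regular: "\<And>u. u \<in> {0..2 * pi} \<Longrightarrow> vector_derivative (rho Q a b) (at u) \<noteq> 0"
    and alpha_nonneg: "\<alpha> \<ge> 0"
begin

abbreviation \<Gamma> :: "real \<Rightarrow> nat \<Rightarrow> real"
  where "\<Gamma> d \<equiv> params Q d \<phi>0 \<psi> a b"

definition dir :: "real^2"
  where "dir = vector [cos \<phi>0, sin \<phi>0]"

text \<open>The distance 0 is a placeholder, here and in the next three definitions: by
  \<open>shape_params\<close> and \<open>shape_deriv_params\<close> any other distance gives the
  same function.\<close>

definition curve :: "real \<Rightarrow> real^2"
  where "curve u = shape Q (\<lambda>k. sigma k u) (\<lambda>k. varsigma k u) (\<Gamma> 0)"

definition velocity :: "real \<Rightarrow> real^2"
  where "velocity u = shape Q (\<lambda>k. dsigma k u) (\<lambda>k. dvarsigma k u) (\<Gamma> 0)"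

definition dcurve :: "nat \<Rightarrow> real \<Rightarrow> real^2"
  where "dcurve i u = shape_deriv Q (\<lambda>k. sigma k u) (\<lambda>k. varsigma k u) (\<Gamma> 0) i"

definition dvelocity :: "nat \<Rightarrow> real \<Rightarrow> real^2"
  where "dvelocity i u = shape_deriv Q (\<lambda>k. dsigma k u) (\<lambda>k. dvarsigma k u) (\<Gamma> 0) i"

lemma norm_dir [simp]: "norm dir = 1"
  by (simp add: dir_def)

lemma inner_dir_dir [simp]: "dir \<bullet> dir = 1"
  by (simp add: norm_eq_1[symmetric])

lemma \<Gamma>_simps: "\<Gamma> d (Suc 0) = d" "\<Gamma> d 2 = \<phi>0" "\<Gamma> d 3 = \<psi>"
  by (simp_all add: params_def)

text \<open>Coefficients are read back faithfully only in range: \<open>acoef\<close> returns \<psi>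
  at 0 and runs into \<open>b\<close> beyond \<open>Q\<close>. The sums range over
  \<open>1..Q\<close>, so the next lemmas rewrite below the sum with a congruence rule.\<close>

lemma coef_params:
  "Suc 0 \<le> k \<Longrightarrow> k \<le> Q \<Longrightarrow> acoef (\<Gamma> d) k = a k" "Suc 0 \<le> k \<Longrightarrow> k \<le> Q \<Longrightarrow> bcoef Q (\<Gamma> d) k = b k"
  by (auto simp: acoef_def bcoef_def params_def)

lemma rho_params: "rho Q (acoef (\<Gamma> d)) (bcoef Q (\<Gamma> d)) = rho Q a b"
  unfolding rho_def[abs_def] by (simp add: coef_params cong: sum.cong_simp)

lemma drho_params: "drho Q (acoef (\<Gamma> d)) (bcoef Q (\<Gamma> d)) = drho Q a b"
  unfolding drho_def[abs_def] by (simp add: coef_params cong: sum.cong_simp)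

lemma shape_params: "shape Q f g (\<Gamma> d) = shape Q f g (\<Gamma> 0)"
  unfolding shape_def by (simp add: \<Gamma>_simps coef_params cong: sum.cong_simp)

lemma shape_deriv_params: "shape_deriv Q f g (\<Gamma> d) i = shape_deriv Q f g (\<Gamma> 0) i"
  unfolding shape_deriv_def by (simp add: \<Gamma>_simps shape_params[of _ _ d])

lemma centre_params: "centre (\<Gamma> d) = d *\<^sub>R dir"
  by (simp add: centre_def \<Gamma>_simps dir_def)

lemma contour_params: "contour Q (\<Gamma> d) u = d *\<^sub>R dir + curve u"
  by (simp add: contour_eq_shape centre_params curve_def shape_params[of _ _ d])

lemma tangent_params: "tangent Q (\<Gamma> d) u = velocity u"
  by (simp add: tangent_eq_shape velocity_def shape_params[of _ _ d])

lemma curve_eq: "curve u = rot \<psi> *v rho Q a b u"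
  using contour_eq_shape[of Q "\<Gamma> 0" u]
  by (simp add: contour_def curve_def \<Gamma>_simps rho_params)

lemma velocity_eq: "velocity u = rot \<psi> *v drho Q a b u"
  by (simp add: tangent_params[of 0, symmetric] tangent_eq \<Gamma>_simps drho_params)

lemma curve_deriv: "(curve has_vector_derivative velocity u) (at u)"
  unfolding curve_eq[abs_def] velocity_eq
  by (rule bounded_linear.has_vector_derivative[OF matrix_vector_mul_bounded_linear rho_deriv])

lemma continuous_on_curve [continuous_intros]: "continuous_on S curve"
  and continuous_on_velocity [continuous_intros]: "continuous_on S velocity"
  and continuous_on_dcurve [continuous_intros]: "continuous_on S (dcurve i)"
  and continuous_on_dvelocity [continuous_intros]: "continuous_on S (dvelocity i)"
  unfolding curve_def[abs_def] velocity_def[abs_def] dcurve_def[abs_def] dvelocity_def[abs_def]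
  by (intro continuous_intros)+

lemma curve_bounded: "\<exists>K>0. \<forall>u. norm (curve u) \<le> K"
proof -
  have "\<exists>K. \<forall>u. norm (curve u) \<le> K"
    unfolding curve_def
    by (intro exI allI, rule norm_shape_le[where h = "\<lambda>_. 1"]) (rule abs_trig_basis_le)+
  then obtain K where "\<And>u. norm (curve u) \<le> K" by blast
  then show ?thesis by (intro exI[of _ "max K 1"]) (auto simp: max.coboundedI1)
qed

lemma velocity_bounded: "\<exists>K>0. \<forall>u. norm (velocity u) \<le> K"
proof -
  have "\<exists>K. \<forall>u. norm (velocity u) \<le> K"
    unfolding velocity_def
    by (intro exI allI, rule norm_shape_le[where h = real]) (rule abs_trig_basis_le)+
  then obtain K where "\<And>u. norm (velocity u) \<le> K" by blast
  then show ?thesis by (intro exI[of _ "max K 1"]) (auto simp: max.coboundedI1)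
qed

lemma dcurve_bounded: "\<exists>K>0. \<forall>u. norm (dcurve i u) \<le> K"
proof -
  obtain K where K: "K > 0" "\<And>u. norm (curve u) \<le> K" using curve_bounded by blast
  have "norm (dcurve i u) \<le> K + 1 + 1" for u
    unfolding dcurve_def
    by (rule order_trans[OF norm_shape_deriv_le])
      (intro add_mono abs_trig_basis_le K(2)[unfolded curve_def])
  with K(1) show ?thesis by (intro exI[of _ "K + 1 + 1"]) auto
qed

lemma dvelocity_bounded: "\<exists>K>0. \<forall>u. norm (dvelocity i u) \<le> K"
proof -
  obtain K where K: "K > 0" "\<And>u. norm (velocity u) \<le> K" using velocity_bounded by blast
  have "norm (dvelocity i u) \<le> K + real (i - 3) + real (i - 3 - Q)" for u
    unfolding dvelocity_def
    by (rule order_trans[OF norm_shape_deriv_le])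
      (intro add_mono abs_trig_basis_le K(2)[unfolded velocity_def])
  with K(1) show ?thesis
    by (intro exI[of _ "K + real (i - 3) + real (i - 3 - Q)"]) auto
qed

lemma velocity_periodic: "velocity (u - 2 * pi * of_int n) = velocity u"
proof -
  have "real k * (u - 2 * pi * of_int n) = real k * u - 2 * pi * of_int (int k * n)" for k
    by (simp add: algebra_simps)
  then have "dsigma k (u - 2 * pi * of_int n) = dsigma k u"
    and "dvarsigma k (u - 2 * pi * of_int n) = dvarsigma k u" for k
    by (simp_all only: dsigma_def dvarsigma_def sin_diff cos_diff cos_int_2pin sin_int_2pin) simp_all
  then show ?thesis by (simp add: velocity_def)
qed

lemma curve_2pi: "curve (2 * pi) = curve 0"
proof -
  have "real k * (2 * pi) = 2 * pi * of_int (int k)" for k by simp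
  then have "sigma k (2 * pi) = sigma k 0" "varsigma k (2 * pi) = varsigma k 0" for k
    by (simp_all only: sigma_def varsigma_def cos_int_2pin sin_int_2pin) simp_all
  then show ?thesis by (simp add: curve_def)
qed

text \<open>Regularity is assumed on one period only. Compactness turns it into a positive minimum
  there, and periodicity carries the bound to the whole line, on which all uniform limits are
  stated.\<close>

lemma velocity_lower: "\<exists>m>0. \<forall>u. norm (velocity u) \<ge> m"
proof -
  have "continuous_on {0..2 * pi} (\<lambda>u. norm (velocity u))"
    by (intro continuous_intros)
  then obtain u0 where u0: "u0 \<in> {0..2 * pi}"
      "\<And>u. u \<in> {0..2 * pi} \<Longrightarrow> norm (velocity u0) \<le> norm (velocity u)"
    using continuous_attains_inf[of "{0..2 * pi}" "\<lambda>u. norm (velocity u)"] by auto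
  have "drho Q a b u0 \<noteq> 0"
    using regular[OF u0(1)] by (simp add: vector_derivative_rho)
  then have "norm (velocity u0) > 0"
    by (simp add: velocity_eq del: zero_less_norm_iff) simp
  moreover have "norm (velocity u0) \<le> norm (velocity u)" for u
  proof -
    define n where "n = \<lfloor>u / (2 * pi)\<rfloor>"
    have "of_int n \<le> u / (2 * pi)" "u / (2 * pi) < of_int n + 1"
      by (simp_all add: n_def)
    then have "u - 2 * pi * of_int n \<in> {0..2 * pi}"
      by (simp add: field_simps)
    from u0(2)[OF this] show ?thesis by (simp only: velocity_periodic)
  qed
  ultimately show ?thesis by blast
qed

lemma velocity_nonzero [simp]: "velocity u \<noteq> 0"
  using velocity_lower by (metis norm_zero not_less)

section \<open>The far-field limit\<close>

lemma norm_contour_bounds: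
  "\<exists>K>0. (\<forall>u. norm (curve u) \<le> K) \<and> (\<forall>d u. \<bar>norm (contour Q (\<Gamma> d) u) - \<bar>d\<bar>\<bar> \<le> K)"
proof -
  obtain K where K: "K > 0" "\<And>u. norm (curve u) \<le> K" using curve_bounded by blast
  have "\<bar>norm (contour Q (\<Gamma> d) u) - \<bar>d\<bar>\<bar> \<le> K" for d u
    using norm_triangle_ineq3[of "d *\<^sub>R dir + curve u" "d *\<^sub>R dir"] K(2)[of u]
    by (simp add: contour_params)
  with K show ?thesis by blast
qed

lemma contour_nonzero: "\<forall>\<^sub>F d in at_top. \<forall>u. contour Q (\<Gamma> d) u \<noteq> 0"
proof -
  obtain K where K: "K > 0" "\<And>d u. \<bar>norm (contour Q (\<Gamma> d) u) - \<bar>d\<bar>\<bar> \<le> K"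
    using norm_contour_bounds by blast
  show ?thesis
    using eventually_gt_at_top[of K]
  proof eventually_elim
    case (elim d)
    show ?case
    proof
      fix u show "contour Q (\<Gamma> d) u \<noteq> 0"
        using K(2)[of d u] elim K(1) by auto
    qed
  qed
qed

lemma inverse_norm_lim:
  "uniform_limit UNIV (\<lambda>d u. inverse (norm (contour Q (\<Gamma> d) u))) (\<lambda>_. 0) at_top"
proof -
  obtain K where K: "K > 0" "\<And>d u. \<bar>norm (contour Q (\<Gamma> d) u) - \<bar>d\<bar>\<bar> \<le> K"
    using norm_contour_bounds by blast
  show ?thesis
  proof (rule uniform_limit_bound)
    show "((\<lambda>d. inverse (d - K)) \<longlongrightarrow> 0) at_top"
      by (rule tendsto_inverse_shift)
    show "\<forall>\<^sub>F d in at_top. \<forall>u\<in>UNIV. dist (inverse (norm (contour Q (\<Gamma> d) u))) 0 \<le> inverse (d - K)"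
      using eventually_gt_at_top[of K]
    proof eventually_elim
      case (elim d)
      show ?case
      proof
        fix u show "dist (inverse (norm (contour Q (\<Gamma> d) u))) 0 \<le> inverse (d - K)"
          using K(2)[of d u] elim K(1) by (auto intro!: le_imp_inverse_le)
      qed
    qed
  qed
qed

lemma dist_ratio_lim:
  "uniform_limit UNIV (\<lambda>d u. d * inverse (norm (contour Q (\<Gamma> d) u))) (\<lambda>_. 1) at_top"
proof -
  obtain K where K: "K > 0" "\<And>d u. \<bar>norm (contour Q (\<Gamma> d) u) - \<bar>d\<bar>\<bar> \<le> K"
    using norm_contour_bounds by blast
  show ?thesis
  proof (rule uniform_limit_bound)
    show "((\<lambda>d. K * inverse (d - K)) \<longlongrightarrow> 0) at_top"
      by (intro tendsto_mult_right_zero tendsto_inverse_shift)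
    show "\<forall>\<^sub>F d in at_top. \<forall>u\<in>UNIV.
        dist (d * inverse (norm (contour Q (\<Gamma> d) u))) 1 \<le> K * inverse (d - K)"
      using eventually_gt_at_top[of K]
    proof eventually_elim
      case (elim d)
      show ?case
      proof
        fix u
        define n where "n = norm (contour Q (\<Gamma> d) u)"
        have n: "\<bar>n - d\<bar> \<le> K" "n \<ge> d - K"
          using K(2)[of d u] elim K(1) by (auto simp: n_def)
        have "d * inverse n - 1 = (d - n) * inverse n"
          using n elim by (simp add: field_simps)
        then have "\<bar>d * inverse n - 1\<bar> = \<bar>n - d\<bar> * inverse n"
          using n elim by (simp add: abs_mult abs_minus_commute)
        also have "\<dots> \<le> K * inverse (d - K)"
          using n elim K(1) by (intro mult_mono) (auto intro!: le_imp_inverse_le)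
        finally show "dist (d * inverse (norm (contour Q (\<Gamma> d) u))) 1 \<le> K * inverse (d - K)"
          by (simp add: dist_real_def n_def)
      qed
    qed
  qed
qed

text \<open>The unit vector is \<open>d / norm r\<close> times \<open>dir\<close> plus
  \<open>curve u / norm r\<close>, where r is the point of the contour; the first coefficient tends
  to 1, and the second term to 0 because the curve is bounded.\<close>

lemma sgn_contour_lim:
  "uniform_limit UNIV (\<lambda>d u. sgn (contour Q (\<Gamma> d) u)) (\<lambda>_. dir) at_top"
proof -
  obtain K where K: "K > 0" "\<And>u. norm (curve u) \<le> K" using curve_bounded by blast
  have 1: "uniform_limit UNIV (\<lambda>d u. (d * inverse (norm (contour Q (\<Gamma> d) u))) *\<^sub>R dir) (\<lambda>_. 1 *\<^sub>R dir) at_top"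
    by (intro uniform_limit_intros dist_ratio_lim) (auto simp: image_constant_conv)
  have 2: "uniform_limit UNIV (\<lambda>d u. inverse (norm (contour Q (\<Gamma> d) u)) *\<^sub>R curve u) (\<lambda>u. 0 *\<^sub>R curve u) at_top"
    by (intro bounded_bilinear.bounded_uniform_limit[OF bounded_bilinear_scaleR]
        inverse_norm_lim uniform_limit_const) (use K(2) in \<open>auto simp: image_constant_conv intro!: boundedI\<close>)
  show ?thesis
    using uniform_limit_add[OF 1 2]
    by (simp add: sgn_div_norm contour_params scaleR_add_right mult.commute)
qed

text \<open>The limit of the radial component of the parameter derivative of the contour. For
  \<open>i = 2\<close> that derivative is \<open>d *\<^sub>R perp dir\<close>: the deviation of the
  line of sight from \<open>dir\<close>, of order 1/d, is multiplied by d and leaves a finite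
  term.\<close>

definition mu_lim :: "nat \<Rightarrow> real \<Rightarrow> real"
  where "mu_lim i u = (if i = 1 then 1 else if i = 2 then curve u \<bullet> perp dir else dir \<bullet> dcurve i u)"

text \<open>The other parameters displace a point by a bounded amount, which is seen from the origin
  under an angle of order 1/d. Only the bearing of the centre moves it by an amount proportional to
  d.\<close>

definition eta_lim :: "nat \<Rightarrow> real \<Rightarrow> real"
  where "eta_lim i u = of_bool (i = 2)"

definition beta_deriv :: "nat \<Rightarrow> real \<Rightarrow> real"
  where "beta_deriv i u = (perp (velocity u) \<bullet> dvelocity i u) / (norm (velocity u))\<^sup>2"

definition xi_lim :: "nat \<Rightarrow> real \<Rightarrow> real"
  where "xi_lim i u = eta_lim i u - beta_deriv i u"

lemma centre_deriv_params:
  "centre_deriv (\<Gamma> d) i = (if i = 1 then dir else if i = 2 then d *\<^sub>R perp dir else 0)"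
  unfolding centre_deriv_def centre_params perp_scaleR by (simp add: \<Gamma>_simps dir_def)

lemma mu_eq:
  assumes "i \<in> {1..2 * Q + 3}" "contour Q (\<Gamma> d) u \<noteq> 0"
  shows "mu Q (\<Gamma> d) i u = sgn (contour Q (\<Gamma> d) u) \<bullet> (centre_deriv (\<Gamma> d) i + dcurve i u)"
proof -
  have "((\<lambda>x. dist_r Q ((\<Gamma> d)(i := x)) u) has_real_derivative
    contour Q (\<Gamma> d) u \<bullet> (centre_deriv (\<Gamma> d) i + dcurve i u) / norm (contour Q (\<Gamma> d) u)) (at (\<Gamma> d i))"
    using deriv_norm[OF contour_param_deriv[OF assms(1), of "\<Gamma> d" u]] assms(2)
    by (simp add: dist_r_def dcurve_def shape_deriv_params[of _ _ d])
  then show ?thesis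
    unfolding mu_def by (simp add: DERIV_imp_deriv sgn_div_norm divide_inverse mult.commute)
qed

lemma eta_eq:
  assumes "i \<in> {1..2 * Q + 3}" "contour Q (\<Gamma> d) u \<noteq> 0"
  shows "eta Q (\<Gamma> d) i u =
    (perp (sgn (contour Q (\<Gamma> d) u)) \<bullet> (centre_deriv (\<Gamma> d) i + dcurve i u))
      * inverse (norm (contour Q (\<Gamma> d) u))"
  using angle_deriv_eq[OF contour_param_deriv[OF assms(1), of "\<Gamma> d" u]] assms(2)
  by (simp add: eta_def dcurve_def shape_deriv_params[of _ _ d] sgn_div_norm perp_scaleR
      divide_inverse power2_eq_square)

lemma xi_eq:
  assumes "i \<in> {1..2 * Q + 3}"
  shows "xi Q (\<Gamma> d) i u = eta Q (\<Gamma> d) i u - beta_deriv i u"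
  using angle_deriv_eq[OF tangent_param_deriv[OF assms, of "\<Gamma> d" u]]
  by (simp add: xi_def beta_deriv_def tangent_params dvelocity_def shape_deriv_params[of _ _ d])

lemma continuous_contour:
  assumes "\<forall>u. contour Q (\<Gamma> d) u \<noteq> 0"
  shows "continuous_on S (\<lambda>u. sgn (contour Q (\<Gamma> d) u))"
    "continuous_on S (\<lambda>u. inverse (norm (contour Q (\<Gamma> d) u)))"
  using assms unfolding contour_params by (auto intro!: continuous_intros)

lemma mu_close:
  assumes i: "i \<in> {1..2 * Q + 3}"
  shows "close (\<lambda>d. mu Q (\<Gamma> d) i) (\<lambda>d. mu_lim i)"
proof (rule close_limit)
  obtain K where K: "K > 0" "\<And>u. norm (curve u) \<le> K" using curve_bounded by blast
  obtain K' where K': "K' > 0" "\<And>u. norm (dcurve i u) \<le> K'" using dcurve_bounded by blast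
  have bdd: "bounded (range curve)" "bounded (range (dcurve i))"
    using K(2) K'(2) by (auto intro!: boundedI)
  have cp: "\<bar>curve u \<bullet> perp dir\<bar> \<le> K" for u
    using Cauchy_Schwarz_ineq2[of "curve u" "perp dir"] K(2)[of u] by simp
  have eq: "\<forall>\<^sub>F d in at_top. \<forall>u. mu Q (\<Gamma> d) i u =
      sgn (contour Q (\<Gamma> d) u) \<bullet> (centre_deriv (\<Gamma> d) i + dcurve i u)"
    using contour_nonzero by eventually_elim (simp add: mu_eq[OF i])
  show "\<forall>\<^sub>F d in at_top. mu Q (\<Gamma> d) i \<in> borel_measurable borel"
    using eq contour_nonzero
  proof eventually_elim
    case (elim d)
    have "continuous_on UNIV (mu Q (\<Gamma> d) i)"
      unfolding elim(1)[rule_format, abs_def]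
      by (intro continuous_intros continuous_contour elim(2))
    then show ?case by (rule borel_measurable_continuous_onI)
  qed
  have "continuous_on UNIV (mu_lim i)"
    unfolding mu_lim_def[abs_def]
    by (cases "i = 1"; cases "i = 2") (simp_all add: continuous_intros)
  then show "mu_lim i \<in> borel_measurable borel" by (rule borel_measurable_continuous_onI)
  have "\<bar>mu_lim i u\<bar> \<le> 1 + K + K'" for u
  proof -
    have "\<bar>dir \<bullet> dcurve i u\<bar> \<le> K'"
      using Cauchy_Schwarz_ineq2[of dir "dcurve i u"] K'(2)[of u] by simp
    then show ?thesis using K(1) K'(1) cp[of u] by (auto simp: mu_lim_def)
  qed
  then show "\<exists>K. \<forall>u. \<bar>mu_lim i u\<bar> \<le> K" by blast
  have "uniform_limit UNIV (\<lambda>d u. sgn (contour Q (\<Gamma> d) u) \<bullet> (centre_deriv (\<Gamma> d) i + dcurve i u))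
    (mu_lim i) at_top"
  proof -
    consider "i = 1" | "i = 2" | "i \<ge> 3" using i by fastforce
    then show ?thesis
    proof cases
      case 1
      have "uniform_limit UNIV (\<lambda>d u. sgn (contour Q (\<Gamma> d) u) \<bullet> dir) (\<lambda>u. dir \<bullet> dir) at_top"
        by (intro uniform_limit_intros sgn_contour_lim)
      then show ?thesis
        using 1 by (simp add: centre_deriv_params dcurve_def shape_deriv_def mu_lim_def[abs_def])
    next
      \<comment> \<open>The part of the contour point along \<open>dir\<close> is orthogonal to
        \<open>perp dir\<close>; only \<open>curve u\<close> contributes, and the growing factor d
        is absorbed in the ratio of d to the distance, which tends to 1.\<close>
      case 2
      have "uniform_limit UNIV (\<lambda>d u. (d * inverse (norm (contour Q (\<Gamma> d) u))) * (curve u \<bullet> perp dir))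
         (\<lambda>u. 1 * (curve u \<bullet> perp dir)) at_top"
        by (intro uniform_lim_mult dist_ratio_lim uniform_limit_const)
          (use cp in \<open>auto simp: image_constant_conv intro!: boundedI\<close>)
      moreover have "sgn (contour Q (\<Gamma> d) u) \<bullet> perp dir
          = inverse (norm (contour Q (\<Gamma> d) u)) * (curve u \<bullet> perp dir)" for d u
        by (simp add: sgn_div_norm contour_params inner_add_left)
      ultimately show ?thesis
        using 2 by (simp add: centre_deriv_params dcurve_def shape_deriv_def mu_lim_def[abs_def] mult.assoc)
    next
      case 3
      have "uniform_limit UNIV (\<lambda>d u. sgn (contour Q (\<Gamma> d) u) \<bullet> dcurve i u) (\<lambda>u. dir \<bullet> dcurve i u) at_top"
        by (intro bounded_bilinear_bounded_uniform_limit_intros(1) sgn_contour_lim uniform_limit_const bdd)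
          (auto simp: image_constant_conv)
      then show ?thesis
        using 3 by (simp add: centre_deriv_params mu_lim_def[abs_def])
    qed
  qed
  then show "uniform_limit UNIV (\<lambda>d. mu Q (\<Gamma> d) i) (mu_lim i) at_top"
    by (subst uniform_limit_cong[where g = "\<lambda>d u. sgn (contour Q (\<Gamma> d) u) \<bullet> (centre_deriv (\<Gamma> d) i + dcurve i u)" and i = "mu_lim i"])
      (use eq in auto)
qed

lemma eta_close:
  assumes i: "i \<in> {1..2 * Q + 3}"
  shows "close (\<lambda>d. eta Q (\<Gamma> d) i) (\<lambda>d. eta_lim i)"
proof (rule close_limit)
  obtain K' where K': "K' > 0" "\<And>u. norm (dcurve i u) \<le> K'" using dcurve_bounded by blast
  have bdd: "bounded (range (dcurve i))"
    using K'(2) by (auto intro!: boundedI)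
  have eq: "\<forall>\<^sub>F d in at_top. \<forall>u. eta Q (\<Gamma> d) i u =
      (perp (sgn (contour Q (\<Gamma> d) u)) \<bullet> (centre_deriv (\<Gamma> d) i + dcurve i u))
        * inverse (norm (contour Q (\<Gamma> d) u))"
    using contour_nonzero by eventually_elim (simp add: eta_eq[OF i])
  show "\<forall>\<^sub>F d in at_top. eta Q (\<Gamma> d) i \<in> borel_measurable borel"
    using eq contour_nonzero
  proof eventually_elim
    case (elim d)
    have "continuous_on UNIV (eta Q (\<Gamma> d) i)"
      unfolding elim(1)[rule_format, abs_def]
      by (intro continuous_intros continuous_contour elim(2))
    then show ?case by (rule borel_measurable_continuous_onI)
  qed
  show "eta_lim i \<in> borel_measurable borel"
    unfolding eta_lim_def[abs_def] by simp
  show "\<exists>K. \<forall>u. \<bar>eta_lim i u\<bar> \<le> K" by (intro exI[of _ 1]) (simp add: eta_lim_def)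
  have "uniform_limit UNIV (\<lambda>d u. (perp (sgn (contour Q (\<Gamma> d) u)) \<bullet> (centre_deriv (\<Gamma> d) i + dcurve i u))
        * inverse (norm (contour Q (\<Gamma> d) u)))
    (eta_lim i) at_top"
  proof (cases "i = 2")
    \<comment> \<open>Since \<open>perp\<close> preserves inner products, the expression is the
      ratio of d to the distance times the cosine between line of sight and \<open>dir\<close>; both
      tend to 1.\<close>
    case True
    have "uniform_limit UNIV (\<lambda>d u. (d * inverse (norm (contour Q (\<Gamma> d) u))) * (sgn (contour Q (\<Gamma> d) u) \<bullet> dir))
        (\<lambda>u. 1 * (dir \<bullet> dir)) at_top"
      by (intro uniform_lim_mult uniform_limit_intros dist_ratio_lim sgn_contour_lim)
        (auto simp: image_constant_conv)
    then show ?thesis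
      using True
      by (simp add: centre_deriv_params dcurve_def shape_deriv_def eta_lim_def[abs_def] mult_ac)
  next
    case False
    \<comment> \<open>\<open>z\<close> is the derivative of the centre, now bounded. Moving
      \<open>perp\<close> to the other factor pairs the convergent unit vector with a function
      independent of d; the change of sign is harmless as the limit is 0.\<close>
    define z where "z = (if i = 1 then dir else 0)"
    have zK: "norm (z + dcurve i u) \<le> 1 + K'" for u
      using norm_triangle_ineq[of z "dcurve i u"] K'(2)[of u] by (simp add: z_def split: if_splits)
    have "bounded (range (\<lambda>u. perp (z + dcurve i u)))"
      using zK by (auto intro!: boundedI)
    then have 1: "uniform_limit UNIV (\<lambda>d u. sgn (contour Q (\<Gamma> d) u) \<bullet> perp (z + dcurve i u))
        (\<lambda>u. dir \<bullet> perp (z + dcurve i u)) at_top"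
      by (intro bounded_bilinear_bounded_uniform_limit_intros(1) sgn_contour_lim uniform_limit_const)
          (auto simp: image_constant_conv)
    have "uniform_limit UNIV (\<lambda>d u. (sgn (contour Q (\<Gamma> d) u) \<bullet> perp (z + dcurve i u))
          * inverse (norm (contour Q (\<Gamma> d) u)))
        (\<lambda>u. (dir \<bullet> perp (z + dcurve i u)) * 0) at_top"
    proof (intro uniform_lim_mult 1 inverse_norm_lim)
      show "bounded (range (\<lambda>u. dir \<bullet> perp (z + dcurve i u)))"
      proof (rule boundedI[where B = "1 + K'"], clarify)
        fix u
        show "norm (dir \<bullet> perp (z + dcurve i u)) \<le> 1 + K'"
          using Cauchy_Schwarz_ineq2[of dir "perp (z + dcurve i u)"] zK[of u] by simp
      qed
    qed (auto simp: image_constant_conv)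
    moreover note perp_inner_left
    moreover have "centre_deriv (\<Gamma> d) i = z" for d
      using False by (simp add: centre_deriv_params z_def)
    ultimately show ?thesis
      using uniform_limit_uminus False by (fastforce simp: eta_lim_def[abs_def])
  qed
  then show "uniform_limit UNIV (\<lambda>d. eta Q (\<Gamma> d) i) (eta_lim i) at_top"
    by (subst uniform_limit_cong[where g = "\<lambda>d u. (perp (sgn (contour Q (\<Gamma> d) u)) \<bullet> (centre_deriv (\<Gamma> d) i + dcurve i u))
        * inverse (norm (contour Q (\<Gamma> d) u))" and i = "eta_lim i"])
      (use eq in auto)
qed

lemma beta_deriv_bounded: "bounded_family (\<lambda>d. beta_deriv i)"
proof -
  obtain m where m: "m > 0" "\<And>u. norm (velocity u) \<ge> m" using velocity_lower by blast
  obtain K where K: "K > 0" "\<And>u. norm (dvelocity i u) \<le> K" using dvelocity_bounded by blast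
  have "continuous_on UNIV (beta_deriv i)"
    unfolding beta_deriv_def[abs_def] by (intro continuous_intros) simp
  moreover have "\<bar>beta_deriv i u\<bar> \<le> K / m" for u
  proof -
    have v: "norm (velocity u) > 0" by simp
    have "\<bar>perp (velocity u) \<bullet> dvelocity i u\<bar> \<le> norm (velocity u) * norm (dvelocity i u)"
      using Cauchy_Schwarz_ineq2[of "perp (velocity u)"] by simp
    then have "\<bar>beta_deriv i u\<bar> \<le> norm (velocity u) * norm (dvelocity i u) / (norm (velocity u))\<^sup>2"
      by (simp add: beta_deriv_def divide_right_mono)
    also have "\<dots> = norm (dvelocity i u) / norm (velocity u)"
      using v by (simp add: power2_eq_square)
    also have "\<dots> \<le> K / m" using m K by (intro frac_le) auto
    finally show ?thesis .
  qed
  ultimately show ?thesis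
    by (intro bounded_familyI[where K = "K / m"]) (auto intro: borel_measurable_continuous_onI)
qed

lemma xi_close:
  assumes i: "i \<in> {1..2 * Q + 3}"
  shows "close (\<lambda>d. xi Q (\<Gamma> d) i) (\<lambda>d. xi_lim i)"
  using close_diff[OF eta_close[OF i] close_refl[OF beta_deriv_bounded[of i]]]
  by (simp add: xi_lim_def[abs_def] xi_eq[OF i, abs_def])

section \<open>Angles and weights\<close>

lemma cos_phi_close: "close (\<lambda>d u. cos (phi Q (\<Gamma> d) u)) (\<lambda>d u. cos \<phi>0)"
proof (rule close_limit)
  have eq: "\<forall>\<^sub>F d in at_top. \<forall>u. cos (phi Q (\<Gamma> d) u) = sgn (contour Q (\<Gamma> d) u) $ 1"
    using contour_nonzero
    by eventually_elim (simp add: phi_def cos_polar_angle sgn_div_norm divide_inverse mult.commute)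
  show "\<forall>\<^sub>F d in at_top. (\<lambda>u. cos (phi Q (\<Gamma> d) u)) \<in> borel_measurable borel"
    using eq contour_nonzero
  proof eventually_elim
    case (elim d)
    have "continuous_on UNIV (\<lambda>u. cos (phi Q (\<Gamma> d) u))"
      unfolding elim(1)[rule_format, abs_def]
      by (intro continuous_intros continuous_contour elim(2))
    then show ?case by (rule borel_measurable_continuous_onI)
  qed
  have "uniform_limit UNIV (\<lambda>d u. sgn (contour Q (\<Gamma> d) u) $ 1) (\<lambda>u. dir $ 1) at_top"
    by (rule bounded_linear.uniform_limit[OF bounded_linear_vec_nth sgn_contour_lim])
  then have "uniform_limit UNIV (\<lambda>d u. sgn (contour Q (\<Gamma> d) u) $ 1) (\<lambda>u. cos \<phi>0) at_top"
    by (simp add: dir_def)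
  then show "uniform_limit UNIV (\<lambda>d u. cos (phi Q (\<Gamma> d) u)) (\<lambda>u. cos \<phi>0) at_top"
    by (subst uniform_limit_cong[where g = "\<lambda>d u. sgn (contour Q (\<Gamma> d) u) $ 1" and i = "\<lambda>u. cos \<phi>0"])
      (use eq in auto)
  show "\<exists>K. \<forall>u::real. \<bar>cos \<phi>0\<bar> \<le> K" by auto
qed simp

text \<open>The principal values \<open>phi\<close> and \<open>beta\<close> jump, but the weights
  see them only through sine and cosine of their difference, which are continuous in the two unit
  vectors.\<close>

lemma sin_phi_beta:
  "\<forall>\<^sub>F d in at_top. \<forall>u. sin (phi Q (\<Gamma> d) u - beta Q (\<Gamma> d) u)
    = - (perp (sgn (contour Q (\<Gamma> d) u)) \<bullet> sgn (velocity u))"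
  using contour_nonzero
  by eventually_elim (simp add: phi_def beta_def tangent_params sin_polar_angle_diff)

lemma cos_phi_beta:
  "\<forall>\<^sub>F d in at_top. \<forall>u. cos (phi Q (\<Gamma> d) u - beta Q (\<Gamma> d) u)
    = sgn (contour Q (\<Gamma> d) u) \<bullet> sgn (velocity u)"
  using contour_nonzero
  by eventually_elim (simp add: phi_def beta_def tangent_params cos_polar_angle_diff)

lemma measurable_sin_cos_phi_beta:
  "\<forall>\<^sub>F d in at_top. (\<lambda>u. sin (phi Q (\<Gamma> d) u - beta Q (\<Gamma> d) u)) \<in> borel_measurable borel
    \<and> (\<lambda>u. cos (phi Q (\<Gamma> d) u - beta Q (\<Gamma> d) u)) \<in> borel_measurable borel"
  using sin_phi_beta cos_phi_beta contour_nonzero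
proof eventually_elim
  case (elim d)
  show ?case
    unfolding elim(1)[rule_format] elim(2)[rule_format]
    by (intro conjI borel_measurable_continuous_onI continuous_intros continuous_contour elim(3))
      simp_all
qed

lemma sinbar_powr_le_1: "p \<ge> 0 \<Longrightarrow> \<bar>sinbar x powr p\<bar> \<le> 1"
  by (simp add: sinbar_def powr_le1)

lemma wt_bounded: "bounded_family (\<lambda>d. wt Q \<alpha> (\<Gamma> d))"
proof (rule bounded_familyI)
  show "\<forall>\<^sub>F d in at_top. wt Q \<alpha> (\<Gamma> d) \<in> borel_measurable borel"
    using measurable_sin_cos_phi_beta
    by eventually_elim (auto simp: wt_def[abs_def] sinbar_def)
  show "\<forall>\<^sub>F d in at_top. \<forall>u. \<bar>wt Q \<alpha> (\<Gamma> d) u\<bar> \<le> 1"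
    using alpha_nonneg unfolding wt_def by (intro always_eventually allI sinbar_powr_le_1) simp
qed

text \<open>At \<alpha> = 0 the power of \<open>sinbar\<close> is an indicator function, so
  measurability is obtained by composition with sine and cosine and not from continuity.\<close>

lemma vt_bounded: "bounded_family (\<lambda>d. vt Q \<alpha> (\<Gamma> d))"
proof (rule bounded_familyI)
  show "\<forall>\<^sub>F d in at_top. vt Q \<alpha> (\<Gamma> d) \<in> borel_measurable borel"
    using measurable_sin_cos_phi_beta
    by eventually_elim (auto simp: vt_def[abs_def] sinbar_def)
  show "\<forall>\<^sub>F d in at_top. \<forall>u. \<bar>vt Q \<alpha> (\<Gamma> d) u\<bar> \<le> 1"
    unfolding vt_def abs_mult
    by (intro always_eventually allI mult_le_one sinbar_powr_le_1 alpha_nonneg) auto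
qed

end

section \<open>Algebra of the star product and of the projection\<close>

lemma star_commute: "star Q \<gamma> f g = star Q \<gamma> g f"
  by (simp add: star_def mult.commute)

text \<open>True for arbitrary functions: if the integral does not exist, both sides are 0.
  Additivity has no such convention to rest on, and is used only for bounded measurable
  functions.\<close>

lemma star_scale_left: "star Q \<gamma> (\<lambda>u. k * f u) g = k * star Q \<gamma> f g"
  by (simp add: star_def mult.assoc)

lemma star_minus_left: "star Q \<gamma> (\<lambda>u. - f u) g = - star Q \<gamma> f g"
  using star_scale_left[of Q \<gamma> "-1"] by simp

lemma star_zero_left: "star Q \<gamma> (\<lambda>u. 0) g = 0"
  using star_scale_left[of Q \<gamma> 0] by simp

lemma star_scale_right: "star Q \<gamma> f (\<lambda>u. k * g u) = k * star Q \<gamma> f g"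
  using star_scale_left[of Q \<gamma> k g f] by (simp add: star_commute)

lemma star_minus_right: "star Q \<gamma> f (\<lambda>u. - g u) = - star Q \<gamma> f g"
  using star_minus_left[of Q \<gamma> g f] by (simp add: star_commute)

lemma star_zero_right: "star Q \<gamma> f (\<lambda>u. 0) = 0"
  using star_zero_left[of Q \<gamma> f] by (simp add: star_commute)

lemma star_norm_sq: "(star_norm Q \<gamma> f)\<^sup>2 = star Q \<gamma> f f"
proof -
  have "star Q \<gamma> f f \<ge> 0"
    unfolding star_def set_lebesgue_integral_def by (intro integral_nonneg_AE) simp
  then show ?thesis by (simp add: star_norm_def)
qed

lemma proj_perp_minus: "proj_perp Q \<alpha> \<gamma> (\<lambda>u. - f u) = (\<lambda>u. - proj_perp Q \<alpha> \<gamma> f u)"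
  by (simp add: proj_perp_def fun_eq_iff star_minus_left)

lemma proj_perp_zero: "proj_perp Q \<alpha> \<gamma> (\<lambda>u. 0) = (\<lambda>u. 0)"
  by (simp add: proj_perp_def fun_eq_iff star_zero_left)

section \<open>Star products and projections of close families\<close>

context far_contour
begin

lemma measurable_speed: "(\<lambda>u. norm (velocity u)) \<in> borel_measurable borel"
  by (intro borel_measurable_continuous_onI continuous_intros)

lemma star_params:
  "star Q (\<Gamma> d) f g = (LINT u:{0..2 * pi}|lborel. f u * g u * norm (velocity u))"
  by (simp add: star_def tangent_params)

lemma star_bounded:
  assumes "bounded_family F" "bounded_family G"
  shows "\<exists>K. \<forall>\<^sub>F d in at_top. \<bar>star Q (\<Gamma> d) (F d) (G d)\<bar> \<le> K"
proof -
  obtain V where V: "V > 0" "\<And>u. norm (velocity u) \<le> V" using velocity_bounded by blast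
  obtain K where K: "K > 0"
      "\<forall>\<^sub>F d in at_top. (\<lambda>u. F d u * G d u) \<in> borel_measurable borel"
      "\<forall>\<^sub>F d in at_top. \<forall>u. \<bar>F d u * G d u\<bar> \<le> K"
    by (rule bounded_familyE[OF bounded_family_mult[OF assms]])
  have "\<forall>\<^sub>F d in at_top. \<bar>star Q (\<Gamma> d) (F d) (G d)\<bar> \<le> K * V * (2 * pi - 0)"
    using K(2,3)
  proof eventually_elim
    case (elim d)
    have "\<bar>F d u * G d u * norm (velocity u)\<bar> \<le> K * V" for u
      using elim(2) K(1) V unfolding abs_mult[of "F d u * G d u"] by (intro mult_mono) auto
    then show ?case
      unfolding star_params
      by (intro abs_set_integral_le borel_measurable_times[OF elim(1) measurable_speed]) auto
  qed
  then show ?thesis ..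
qed

lemma star_close_left:
  assumes FF: "close F F'" and G: "bounded_family G"
  shows "((\<lambda>d. star Q (\<Gamma> d) (F d) (G d) - star Q (\<Gamma> d) (F' d) (G d)) \<longlongrightarrow> 0) at_top"
proof (rule tendstoI)
  fix e :: real assume "e > 0"
  obtain V where V: "V > 0" "\<And>u. norm (velocity u) \<le> V" using velocity_bounded by blast
  obtain K where K: "K > 0"
      "\<forall>\<^sub>F d in at_top. G d \<in> borel_measurable borel"
      "\<forall>\<^sub>F d in at_top. \<forall>u. \<bar>G d u\<bar> \<le> K"
    by (rule bounded_familyE[OF G])
  obtain A where A: "A > 0"
      "\<forall>\<^sub>F d in at_top. F d \<in> borel_measurable borel"
      "\<forall>\<^sub>F d in at_top. \<forall>u. \<bar>F d u\<bar> \<le> A"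
    by (rule bounded_familyE[OF close_bounded(1)[OF FF]])
  obtain B where B: "B > 0"
      "\<forall>\<^sub>F d in at_top. F' d \<in> borel_measurable borel"
      "\<forall>\<^sub>F d in at_top. \<forall>u. \<bar>F' d u\<bar> \<le> B"
    by (rule bounded_familyE[OF close_bounded(2)[OF FF]])
  \<comment> \<open>Chosen so that the final estimate \<open>\<delta> * K * V * (2 * pi)\<close>
    equals \<open>e / 2\<close>.\<close>
  define \<delta> where "\<delta> = e / (2 * (K * V * (2 * pi)))"
  have \<delta>: "\<delta> > 0" using \<open>e > 0\<close> V(1) K(1) by (simp add: \<delta>_def)
  have \<delta>e: "\<delta> * K * V * (2 * pi - 0) < e" using \<open>e > 0\<close> V(1) K(1) by (simp add: \<delta>_def)
  have "\<forall>\<^sub>F d in at_top. \<forall>u\<in>UNIV. dist (F d u - F' d u) 0 < \<delta>"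
    using FF \<delta> unfolding close_def by (intro uniform_limitD) auto
  then show "\<forall>\<^sub>F d in at_top.
      dist (star Q (\<Gamma> d) (F d) (G d) - star Q (\<Gamma> d) (F' d) (G d)) 0 < e"
    using K(2,3) A(2,3) B(2,3)
  proof eventually_elim
    case (elim d)
    \<comment> \<open>Both products must be integrable before their integrals may be
      subtracted.\<close>
    have int: "set_integrable lborel {0..2 * pi} (\<lambda>u. f u * G d u * norm (velocity u))"
      if "f \<in> borel_measurable borel" "\<forall>u. \<bar>f u\<bar> \<le> C" "C > 0" for f C
    proof (rule set_integrable_bounded)
      show "(\<lambda>u. f u * G d u * norm (velocity u)) \<in> borel_measurable borel"
        using that(1) elim(2) by (intro borel_measurable_times measurable_speed)
      show "\<bar>f u * G d u * norm (velocity u)\<bar> \<le> C * K * V" for u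
        using that elim(3) K(1) V unfolding abs_mult by (intro mult_mono) auto
    qed
    have "star Q (\<Gamma> d) (F d) (G d) - star Q (\<Gamma> d) (F' d) (G d)
      = (LINT u:{0..2 * pi}|lborel. (F d u - F' d u) * G d u * norm (velocity u))"
      unfolding star_params
      by (subst set_integral_diff(2)[symmetric])
        (use int[OF elim(4,5) A(1)] int[OF elim(6,7) B(1)] in \<open>simp_all add: left_diff_distrib\<close>)
    also have "\<bar>\<dots>\<bar> \<le> \<delta> * K * V * (2 * pi - 0)"
    proof (rule abs_set_integral_le)
      show "(\<lambda>u. (F d u - F' d u) * G d u * norm (velocity u)) \<in> borel_measurable borel"
        using elim by (intro borel_measurable_times borel_measurable_diff measurable_speed)
      have "\<bar>F d u - F' d u\<bar> \<le> \<delta>" for u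
        using bspec[OF elim(1) UNIV_I, of u] by (simp add: dist_real_def)
      then show "\<bar>(F d u - F' d u) * G d u * norm (velocity u)\<bar> \<le> \<delta> * K * V" for u
        using elim(3) K(1) V \<delta> unfolding abs_mult by (intro mult_mono) auto
    qed simp
    finally show ?case using \<delta>e by simp
  qed
qed

text \<open>First the left factor is exchanged and then the right one, the latter again by
  \<open>star_close_left\<close> through symmetry.\<close>

lemma star_close:
  assumes "close F F'" "close G G'"
  shows "((\<lambda>d. star Q (\<Gamma> d) (F d) (G d) - star Q (\<Gamma> d) (F' d) (G' d)) \<longlongrightarrow> 0) at_top"
  using tendsto_add[OF star_close_left[OF assms(1) close_bounded(1)[OF assms(2)]]
      star_close_left[OF assms(2) close_bounded(2)[OF assms(1)]]]
  by (simp add: star_commute)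

text \<open>\<open>dir \<bullet> perp (velocity u)\<close> has the sign of the limiting sine of
  \<open>phi - beta\<close>. Were it never positive, the coordinate \<open>h\<close> along
  \<open>perp dir\<close> would be nondecreasing, hence constant on a closed curve; the curve would
  run back and forth on a line and come to rest where it turns.\<close>

lemma exists_facing_side: "\<exists>u\<in>{0..2 * pi}. dir \<bullet> perp (velocity u) > 0"
proof (rule ccontr)
  assume "\<not> ?thesis"
  then have neg: "u \<in> {0..2 * pi} \<Longrightarrow> perp dir \<bullet> velocity u \<ge> 0" for u
    by (simp add: perp_inner_left not_less)
  define h where "h = (\<lambda>u. perp dir \<bullet> curve u)"
  have inn: "((\<lambda>u. z \<bullet> curve u) has_real_derivative z \<bullet> velocity u) (at u)" for z u
    using bounded_linear.has_vector_derivative[OF bounded_linear_inner_right curve_deriv, of z]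
    by (simp add: has_real_derivative_iff_has_vector_derivative)
  have mono: "h x \<le> h y" if "x \<le> y" "0 \<le> x" "y \<le> 2 * pi" for x y
    unfolding h_def
    by (rule DERIV_nonneg_imp_nondecreasing[OF that(1)]) (use inn neg that in force)
  \<comment> \<open>Rolle's theorem for the coordinate along \<open>dir\<close> finds the turning
    point directly: there the nonzero velocity can only point along \<open>perp dir\<close>, so
    \<open>h\<close> is strictly increasing just after it.\<close>
  have "\<exists>z>0. z < 2 * pi \<and> dir \<bullet> velocity z = 0"
  proof (rule Rolle_deriv[where f = "\<lambda>u. dir \<bullet> curve u" and f' = "\<lambda>u t. t * (dir \<bullet> velocity u)", THEN exE])
    show "continuous_on {0..2 * pi} (\<lambda>u. dir \<bullet> curve u)" by (intro continuous_intros)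
    show "((\<lambda>u. dir \<bullet> curve u) has_derivative (\<lambda>t. t * (dir \<bullet> velocity u))) (at u)" for u
      using inn[of dir u] by (simp add: has_field_derivative_def mult.commute[of _ "dir \<bullet> velocity u"])
    fix z assume "0 < z \<and> z < 2 * pi \<and> (\<lambda>t. t * (dir \<bullet> velocity z)) = (\<lambda>v. 0)"
    then show ?thesis by (auto dest: fun_cong[where x = 1] intro!: exI[of _ z])
  qed (simp_all add: curve_2pi)
  then obtain z where z: "0 < z" "z < 2 * pi" "dir \<bullet> velocity z = 0" by blast
  have "perp dir \<bullet> velocity z \<noteq> 0"
  proof
    assume p: "perp dir \<bullet> velocity z = 0"
    let ?v = "velocity z"
    have e: "cos \<phi>0 * ?v $ 1 + sin \<phi>0 * ?v $ 2 = 0" "cos \<phi>0 * ?v $ 2 - sin \<phi>0 * ?v $ 1 = 0"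
      using z(3) p by (simp_all add: inner_2 dir_def)
    \<comment> \<open>\<open>dir\<close> and \<open>perp dir\<close> form an orthonormal basis: the
      factor 1, written as a sum of squares, expresses each coordinate through the two vanishing
      pairings.\<close>
    have "?v $ 1 = ((sin \<phi>0)\<^sup>2 + (cos \<phi>0)\<^sup>2) * ?v $ 1" "?v $ 2 = ((sin \<phi>0)\<^sup>2 + (cos \<phi>0)\<^sup>2) * ?v $ 2"
      by simp_all
    moreover have "((sin \<phi>0)\<^sup>2 + (cos \<phi>0)\<^sup>2) * ?v $ 1
      = cos \<phi>0 * (cos \<phi>0 * ?v $ 1 + sin \<phi>0 * ?v $ 2) - sin \<phi>0 * (cos \<phi>0 * ?v $ 2 - sin \<phi>0 * ?v $ 1)"
      "((sin \<phi>0)\<^sup>2 + (cos \<phi>0)\<^sup>2) * ?v $ 2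
      = sin \<phi>0 * (cos \<phi>0 * ?v $ 1 + sin \<phi>0 * ?v $ 2) + cos \<phi>0 * (cos \<phi>0 * ?v $ 2 - sin \<phi>0 * ?v $ 1)"
      by (simp_all add: algebra_simps power2_eq_square del: sin_cos_squared_add3)
    ultimately have "?v = 0" unfolding e by (simp add: vector_eq_2)
    then show False by simp
  qed
  then have "perp dir \<bullet> velocity z > 0" using neg[of z] z by simp
  then obtain s where s: "s > 0" "\<And>t. t > 0 \<Longrightarrow> t < s \<Longrightarrow> h z < h (z + t)"
    using DERIV_pos_inc_right[OF inn] unfolding h_def by blast
  \<comment> \<open>\<open>s / 2\<close> keeps \<open>t\<close> strictly below \<open>s\<close>, and
    \<open>2 * pi - z\<close> keeps \<open>z + t\<close> in the period on which \<open>h\<close> is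
    monotone.\<close>
  define t where "t = min (s / 2) (2 * pi - z)"
  have t: "t > 0" "t < s" "z + t \<le> 2 * pi" using s(1) z by (auto simp: t_def)
  have "h 0 \<le> h z" "h z < h (z + t)" "h (z + t) \<le> h (2 * pi)"
    using mono[of 0 z] mono[of "z + t" "2 * pi"] s(2)[of t] t z by auto
  then show False by (simp add: h_def curve_2pi)
qed

lemma sin_phi_beta_lim:
  "uniform_limit UNIV (\<lambda>d u. sin (phi Q (\<Gamma> d) u - beta Q (\<Gamma> d) u))
    (\<lambda>u. dir \<bullet> perp (sgn (velocity u))) at_top"
proof -
  have "bounded (range (\<lambda>u. perp (sgn (velocity u))))"
    by (rule boundedI[where B = 1]) (auto simp: norm_sgn)
  then have "uniform_limit UNIV (\<lambda>d u. sgn (contour Q (\<Gamma> d) u) \<bullet> perp (sgn (velocity u)))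
      (\<lambda>u. dir \<bullet> perp (sgn (velocity u))) at_top"
    by (intro bounded_bilinear_bounded_uniform_limit_intros(1) sgn_contour_lim uniform_limit_const)
      (auto simp: image_constant_conv)
  then show ?thesis
    by (subst uniform_limit_cong[where g = "\<lambda>d u. sgn (contour Q (\<Gamma> d) u) \<bullet> perp (sgn (velocity u))"
          and i = "\<lambda>u. dir \<bullet> perp (sgn (velocity u))"])
      (use sin_phi_beta in \<open>auto simp: perp_inner_left elim: eventually_mono\<close>)
qed

text \<open>On an interval around a facing point the limiting sine exceeds
  \<open>2 * \<epsilon>\<close>, so eventually the sine itself is at least \<open>\<epsilon>\<close>
  and \<open>wt\<close> at least \<open>\<epsilon> powr (\<alpha> + 1)\<close>. With the lower bound
  on the speed this bounds the integral at every large d.\<close>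

lemma star_wt_lower: "\<exists>\<delta>>0. \<forall>\<^sub>F d in at_top. star Q (\<Gamma> d) (wt Q \<alpha> (\<Gamma> d)) (wt Q \<alpha> (\<Gamma> d)) \<ge> \<delta>"
proof -
  define k where "k = (\<lambda>u. dir \<bullet> perp (sgn (velocity u)))"
  obtain V where V: "V > 0" "\<And>u. norm (velocity u) \<le> V" using velocity_bounded by blast
  obtain m where m: "m > 0" "\<And>u. norm (velocity u) \<ge> m" using velocity_lower by blast
  obtain u0 where u0: "u0 \<in> {0..2 * pi}" "dir \<bullet> perp (velocity u0) > 0"
    using exists_facing_side by blast
  have "k u0 > 0" using u0(2) by (simp add: k_def sgn_div_norm perp_scaleR)
  \<comment> \<open>A third leaves room twice: continuity of \<open>k\<close> keeps it above
    \<open>2 * \<epsilon>\<close>, and one \<open>\<epsilon>\<close> is spent on the uniform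
    error.\<close>
  define \<epsilon> where "\<epsilon> = k u0 / 3"
  have \<epsilon>: "\<epsilon> > 0" "2 * \<epsilon> < k u0" using \<open>k u0 > 0\<close> by (simp_all add: \<epsilon>_def)
  have "continuous_on UNIV k" unfolding k_def by (intro continuous_intros) simp
  then have "(k \<longlongrightarrow> k u0) (nhds u0)"
    by (simp add: continuous_on_eq_continuous_at isCont_def tendsto_at_iff_tendsto_nhds)
  from order_tendstoD(1)[OF this \<epsilon>(2)]
  obtain s where s: "s > 0" "\<And>u. dist u u0 < s \<Longrightarrow> k u > 2 * \<epsilon>"
    unfolding eventually_nhds_metric by blast
  \<comment> \<open>The point \<open>u0\<close> may be an end of the period; cutting the
    neighbourhood down to the period still leaves an interval of positive length.\<close>
  define x where "x = max 0 (u0 - s / 2)"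
  define y where "y = min (2 * pi) (u0 + s / 2)"
  have xy: "x < y" "0 \<le> x" "y \<le> 2 * pi"
    using u0(1) s(1) pi_gt_zero by (auto simp: x_def y_def min_def max_def)
  have kxy: "k u > 2 * \<epsilon>" if "u \<in> {x..y}" for u
    using that s(1) by (intro s(2)) (auto simp: x_def y_def dist_real_def)
  define \<omega> where "\<omega> = \<epsilon> powr (\<alpha> + 1)"
  have \<omega>: "\<omega> > 0" using \<epsilon> by (simp add: \<omega>_def)
  obtain K where K: "K > 0"
      "\<forall>\<^sub>F d in at_top. wt Q \<alpha> (\<Gamma> d) \<in> borel_measurable borel"
      "\<forall>\<^sub>F d in at_top. \<forall>u. \<bar>wt Q \<alpha> (\<Gamma> d) u\<bar> \<le> K"
    by (rule bounded_familyE[OF wt_bounded])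
  have "\<forall>\<^sub>F d in at_top. \<forall>u\<in>UNIV. dist (sin (phi Q (\<Gamma> d) u - beta Q (\<Gamma> d) u)) (k u) < \<epsilon>"
    using sin_phi_beta_lim \<epsilon>(1) unfolding k_def by (rule uniform_limitD)
  then have "\<forall>\<^sub>F d in at_top. star Q (\<Gamma> d) (wt Q \<alpha> (\<Gamma> d)) (wt Q \<alpha> (\<Gamma> d)) \<ge> \<omega> * \<omega> * m * (y - x)"
    using K(2,3)
  proof eventually_elim
    case (elim d)
    define f where "f = (\<lambda>u. wt Q \<alpha> (\<Gamma> d) u * wt Q \<alpha> (\<Gamma> d) u * norm (velocity u))"
    have f0: "f u \<ge> 0" for u by (simp add: f_def)
    have "set_integrable lborel {0..2 * pi} f"
    proof (rule set_integrable_bounded)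
      show "f \<in> borel_measurable borel"
        unfolding f_def using elim(2) by (intro borel_measurable_times measurable_speed)
      show "\<bar>f u\<bar> \<le> K * K * V" for u
        unfolding f_def abs_mult using elim(3) K(1) V by (intro mult_mono) auto
    qed
    moreover have "set_integrable lborel {x..y} (\<lambda>u. \<omega> * \<omega> * m)"
      by (rule set_integrable_bounded[where K = "\<bar>\<omega> * \<omega> * m\<bar>"]) simp_all
    moreover have "f u \<ge> \<omega> * \<omega> * m" if "u \<in> {x..y}" for u
    proof -
      have "sin (phi Q (\<Gamma> d) u - beta Q (\<Gamma> d) u) \<ge> \<epsilon>"
        using bspec[OF elim(1) UNIV_I, of u] kxy[OF that] by (simp add: dist_real_def)
      then have "wt Q \<alpha> (\<Gamma> d) u \<ge> \<omega>"
        unfolding wt_def \<omega>_def sinbar_def using \<epsilon>(1) alpha_nonneg by (intro powr_mono2) auto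
      then show ?thesis
        unfolding f_def using \<omega> m by (intro mult_mono) auto
    qed
    ultimately have "(LINT u:{x..y}|lborel. \<omega> * \<omega> * m) \<le> (LINT u:{0..2 * pi}|lborel. f u)"
      unfolding set_lebesgue_integral_def set_integrable_def
      by (intro integral_mono) (use xy f0 in \<open>auto simp: indicator_def\<close>)
    then show ?case
      unfolding star_params f_def[symmetric] using xy by (simp add: set_lebesgue_integral_def mult_ac)
  qed
  moreover have "\<omega> * \<omega> * m * (y - x) > 0" using \<omega> m(1) xy by simp
  ultimately show ?thesis by blast
qed

text \<open>The projection subtracts a multiple of \<open>wt\<close> whose coefficient
  \<open>S\<close> depends on d alone. The lower bound on \<open>W\<close> keeps these coefficients
  bounded and makes the difference of the two tend to 0.\<close>

lemma proj_perp_close: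
  assumes FF: "close F F'"
  shows "close (\<lambda>d. proj_perp Q \<alpha> (\<Gamma> d) (F d)) (\<lambda>d. proj_perp Q \<alpha> (\<Gamma> d) (F' d))"
proof -
  define W where "W = (\<lambda>d. star Q (\<Gamma> d) (wt Q \<alpha> (\<Gamma> d)) (wt Q \<alpha> (\<Gamma> d)))"
  define S where "S = (\<lambda>F d. star Q (\<Gamma> d) (F d) (wt Q \<alpha> (\<Gamma> d)) / W d)"
  obtain \<delta> where \<delta>: "\<delta> > 0" "\<forall>\<^sub>F d in at_top. W d \<ge> \<delta>"
    using star_wt_lower unfolding W_def by blast
  have inv: "\<forall>\<^sub>F d in at_top. \<bar>inverse (W d)\<bar> \<le> inverse \<delta>"
    using \<delta>(2) by eventually_elim (use \<delta>(1) in \<open>auto intro!: le_imp_inverse_le\<close>)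
  have bdd: "bounded_family (\<lambda>d u. S H d)" if H: "bounded_family H" for H
  proof -
    obtain K where "\<forall>\<^sub>F d in at_top. \<bar>star Q (\<Gamma> d) (H d) (wt Q \<alpha> (\<Gamma> d))\<bar> \<le> K"
      using star_bounded[OF H wt_bounded] by blast
    then show ?thesis
      unfolding S_def divide_inverse
      by (intro bounded_family_mult bounded_family_const[OF inv] bounded_family_const)
  qed
  have "((\<lambda>d. S F d - S F' d) \<longlongrightarrow> 0) at_top"
  proof (rule Lim_null_comparison)
    show "((\<lambda>d. \<bar>star Q (\<Gamma> d) (F d) (wt Q \<alpha> (\<Gamma> d)) - star Q (\<Gamma> d) (F' d) (wt Q \<alpha> (\<Gamma> d))\<bar> * inverse \<delta>)
        \<longlongrightarrow> 0) at_top"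
      by (intro tendsto_mult_left_zero tendsto_rabs_zero star_close_left FF wt_bounded)
    show "\<forall>\<^sub>F d in at_top. norm (S F d - S F' d)
      \<le> \<bar>star Q (\<Gamma> d) (F d) (wt Q \<alpha> (\<Gamma> d)) - star Q (\<Gamma> d) (F' d) (wt Q \<alpha> (\<Gamma> d))\<bar> * inverse \<delta>"
      using inv
      by eventually_elim (auto simp: S_def divide_inverse left_diff_distrib[symmetric] abs_mult
          intro!: mult_left_mono)
  qed
  \<comment> \<open>For families constant in u, uniform convergence is convergence of the
    coefficients.\<close>
  then have "close (\<lambda>d u. S F d) (\<lambda>d u. S F' d)"
    unfolding close_def
    by (intro conjI bdd close_bounded[OF FF])
      (auto simp: uniform_limit_iff tendsto_iff)
  then have "close (\<lambda>d u. F d u - S F d * wt Q \<alpha> (\<Gamma> d) u) (\<lambda>d u. F' d u - S F' d * wt Q \<alpha> (\<Gamma> d) u)"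
    by (intro close_diff FF close_mult close_refl wt_bounded)
  then show ?thesis
    by (simp add: proj_perp_def[abs_def] S_def W_def star_norm_sq)
qed

section \<open>The limiting matrix\<close>

lemma pbar_params: "d > 0 \<Longrightarrow> pbar (\<Gamma> d) = dir" "d > 0 \<Longrightarrow> pbar_perp (\<Gamma> d) = perp dir"
  by (simp_all add: pbar_def pbar_perp_def centre_params perp_scaleR)

text \<open>
  Up to the entry \<open>Z\<close>, the limiting matrix is a combination of the Gram matrices of these two
  families of functions.
\<close>

definition normalized_mu_lim :: "real \<Rightarrow> nat \<Rightarrow> real \<Rightarrow> real"
  where "normalized_mu_lim d i = (if i = 1 then wbar Q \<alpha> (\<Gamma> d) else if i = 2 then wpr Q \<alpha> (\<Gamma> d)
    else if i = 3 then (\<lambda>u. - wpr Q \<alpha> (\<Gamma> d) u) else ws_vec Q \<alpha> (\<Gamma> d) (i - 3))"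

definition projected_xi_lim :: "real \<Rightarrow> nat \<Rightarrow> real \<Rightarrow> real"
  where "projected_xi_lim d i = (if i = 1 then (\<lambda>u. 0) else if i = 2 then proj_perp Q \<alpha> (\<Gamma> d) (vt Q \<alpha> (\<Gamma> d))
    else if i = 3 then (\<lambda>u. - proj_perp Q \<alpha> (\<Gamma> d) (vt Q \<alpha> (\<Gamma> d)) u) else t_vec Q \<alpha> (\<Gamma> d) (i - 3))"

text \<open>For the coefficients, moving the rotation from the basis vectors onto \<open>dir\<close>
  turns the pairing in \<open>mu_lim\<close> into the factors of \<open>s_vec\<close>.\<close>

lemma normalized_mu_lim_eq:
  assumes d: "d > 0" and i: "i \<in> {1..2 * Q + 3}"
  shows "normalized_mu_lim d i = (\<lambda>u. inverse (star_norm Q (\<Gamma> d) (wt Q \<alpha> (\<Gamma> d))) * (wt Q \<alpha> (\<Gamma> d) u * mu_lim i u))"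
proof
  fix u
  have wpr: "wpr Q \<alpha> (\<Gamma> d) u = wbar Q \<alpha> (\<Gamma> d) u * (perp dir \<bullet> curve u)"
    by (simp add: wpr_def pbar_params d \<Gamma>_simps rho_params curve_eq)
  consider "i = 1" | "i = 2" | "i = 3" | "3 < i" "i \<le> 3 + Q" | "i > 3 + Q" using i by fastforce
  then show "normalized_mu_lim d i u = inverse (star_norm Q (\<Gamma> d) (wt Q \<alpha> (\<Gamma> d))) * (wt Q \<alpha> (\<Gamma> d) u * mu_lim i u)"
  proof cases
    \<comment> \<open>The derivative in \<psi> is \<open>perp (curve u)\<close>, and skewness of
      \<open>perp\<close> produces the minus sign.\<close>
    case 3
    then show ?thesis
      by (simp add: normalized_mu_lim_def mu_lim_def wpr perp_inner_left wbar_def divide_inverse dcurve_def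
          shape_deriv_def curve_def[symmetric])
  qed (auto simp: normalized_mu_lim_def mu_lim_def wpr wbar_def divide_inverse inner_commute[of "perp dir"]
      ws_vec_def s_vec_def dcurve_def shape_deriv_def pbar_params d mult_rot_nth
      inner_2 \<Gamma>_simps algebra_simps)
qed

lemma deriv_trig_basis: "deriv (sigma k) u = dsigma k u" "deriv (varsigma k) u = dvarsigma k u"
  by (simp_all add: DERIV_imp_deriv sigma_deriv varsigma_deriv)

text \<open>In the limit the distance affects neither angle, the bearing turns only the line of
  sight, and \<psi> turns only the tangent, at unit rate; this gives the values 0, 1 and -1. The
  coefficients act through the tangent alone.\<close>

lemma projected_xi_lim_eq:
  assumes i: "i \<in> {1..2 * Q + 3}"
  shows "projected_xi_lim d i = proj_perp Q \<alpha> (\<Gamma> d) (\<lambda>u. vt Q \<alpha> (\<Gamma> d) u * xi_lim i u)"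
proof -
  consider "i = 1" | "i = 2" | "i = 3" | "3 < i" using i by fastforce
  then show ?thesis
  proof cases
    case 1
    then have "xi_lim i u = 0" for u
      by (simp add: xi_lim_def eta_lim_def beta_deriv_def dvelocity_def shape_deriv_def)
    then show ?thesis using 1 by (simp add: projected_xi_lim_def proj_perp_zero)
  next
    case 2
    then have "xi_lim i u = 1" for u
      by (simp add: xi_lim_def eta_lim_def beta_deriv_def dvelocity_def shape_deriv_def)
    then show ?thesis using 2 by (simp add: projected_xi_lim_def)
  next
    case 3
    then have "xi_lim i u = - 1" for u
      by (simp add: xi_lim_def eta_lim_def beta_deriv_def dvelocity_def shape_deriv_def
          velocity_def[symmetric] power2_norm_eq_inner)
    then show ?thesis using 3 by (simp add: projected_xi_lim_def proj_perp_minus)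
  next
    case 4
    have dr: "drho Q a b u $ 1 = (\<Sum>l=1..Q. dsigma l u * acoef (\<Gamma> d) l)"
      "drho Q a b u $ 2 = (\<Sum>l=1..Q. dvarsigma l u * bcoef Q (\<Gamma> d) l)" for u
      by (simp_all add: drho_params[of d, symmetric] drho_def)
    \<comment> \<open>Velocity and its derivative carry the same rotation, which commutes with
      \<open>perp\<close> and drops out of the inner product.\<close>
    have "xi_lim i u = inverse ((norm (drho Q a b u))\<^sup>2) *
      (if i - 3 \<le> Q then drho Q a b u $ 2 * dsigma (i - 3) u
       else - drho Q a b u $ 1 * dvarsigma (i - 3 - Q) u)" for u
      using 4
      by (simp add: xi_lim_def eta_lim_def beta_deriv_def dvelocity_def shape_deriv_def
          velocity_eq perp_rot \<Gamma>_simps)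
        (auto simp: inner_2 divide_inverse)
    then show ?thesis
      using 4 unfolding projected_xi_lim_def t_vec_def deriv_trig_basis dr[symmetric]
      by (simp add: vector_derivative_rho drho_params divide_inverse mult.assoc)
  qed
qed

text \<open>A comparison of entries, by first, second, third and later index in each argument.
  Positivity of the weight enters through the corner entry L, which requires \<open>wbar\<close> to
  have norm 1.\<close>

lemma T_mat_eq:
  assumes W: "star Q (\<Gamma> d) (wt Q \<alpha> (\<Gamma> d)) (wt Q \<alpha> (\<Gamma> d)) > 0"
    and ij: "i \<in> {1..2 * Q + 3}" "j \<in> {1..2 * Q + 3}"
  shows "T_mat Q \<alpha> L M (\<Gamma> d) i j = L * star Q (\<Gamma> d) (normalized_mu_lim d i) (normalized_mu_lim d j)
    + M * (cos \<phi>0)\<^sup>2 * of_bool (i = 2 \<and> j = 2)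
    + (\<alpha> + 1)\<^sup>2 * star Q (\<Gamma> d) (projected_xi_lim d i) (projected_xi_lim d j) / star Q (\<Gamma> d) (wt Q \<alpha> (\<Gamma> d)) (wt Q \<alpha> (\<Gamma> d))"
proof -
  define W where "W = star Q (\<Gamma> d) (wt Q \<alpha> (\<Gamma> d)) (wt Q \<alpha> (\<Gamma> d))"
  have wb: "wbar Q \<alpha> (\<Gamma> d) = (\<lambda>u. inverse (sqrt W) * wt Q \<alpha> (\<Gamma> d) u)"
    by (simp add: wbar_def[abs_def] star_norm_def W_def divide_inverse mult.commute)
  have "star Q (\<Gamma> d) (wbar Q \<alpha> (\<Gamma> d)) (wbar Q \<alpha> (\<Gamma> d)) = W / (sqrt W * sqrt W)"
    unfolding wb star_scale_left star_scale_right W_def[symmetric] divide_inverse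
      inverse_mult_distrib by (simp only: mult_ac)
  then have w1: "star Q (\<Gamma> d) (wbar Q \<alpha> (\<Gamma> d)) (wbar Q \<alpha> (\<Gamma> d)) = 1"
    using W by (simp add: W_def)
  note defs = T_mat_def T11_def T21_def T22_def normalized_mu_lim_def projected_xi_lim_def Let_def A_const_def B_const_def
    Z_const_def c_vec_def q_vec_def star_norm_sq star_minus_left star_minus_right star_zero_left
    star_zero_right w1 \<Gamma>_simps star_commute
  have "i = 1 \<or> i = 2 \<or> i = 3 \<or> 3 < i" "j = 1 \<or> j = 2 \<or> j = 3 \<or> 3 < j"
    using ij by auto
  then show ?thesis
    by (elim disjE; simp add: defs)
qed

text \<open>Multiplication by the squared norm of the weight removes the normalization in
  \<open>T_mat\<close> and shows it as the bracket of the information matrix with limits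
  inserted.\<close>

lemma T_mat_star:
  assumes W: "star Q (\<Gamma> d) (wt Q \<alpha> (\<Gamma> d)) (wt Q \<alpha> (\<Gamma> d)) > 0" and d: "d > 0"
    and ij: "i \<in> {1..2 * Q + 3}" "j \<in> {1..2 * Q + 3}"
  shows "star Q (\<Gamma> d) (wt Q \<alpha> (\<Gamma> d)) (wt Q \<alpha> (\<Gamma> d)) * T_mat Q \<alpha> L M (\<Gamma> d) i j =
    L * star Q (\<Gamma> d) (\<lambda>u. wt Q \<alpha> (\<Gamma> d) u * mu_lim i u) (\<lambda>u. wt Q \<alpha> (\<Gamma> d) u * mu_lim j u)
    + M * star Q (\<Gamma> d) (\<lambda>u. wt Q \<alpha> (\<Gamma> d) u * cos \<phi>0 * eta_lim i u)
                 (\<lambda>u. wt Q \<alpha> (\<Gamma> d) u * cos \<phi>0 * eta_lim j u)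
    + (\<alpha> + 1)\<^sup>2 * star Q (\<Gamma> d) (proj_perp Q \<alpha> (\<Gamma> d) (\<lambda>u. vt Q \<alpha> (\<Gamma> d) u * xi_lim i u))
                 (proj_perp Q \<alpha> (\<Gamma> d) (\<lambda>u. vt Q \<alpha> (\<Gamma> d) u * xi_lim j u))"
proof -
  define w where "w = wt Q \<alpha> (\<Gamma> d)"
  define W where "W = star Q (\<Gamma> d) w w"
  define X where "X = star Q (\<Gamma> d) (\<lambda>u. w u * mu_lim i u) (\<lambda>u. w u * mu_lim j u)"
  have W0: "W > 0" using assms(1) by (simp add: W_def w_def)
  have "star Q (\<Gamma> d) (normalized_mu_lim d i) (normalized_mu_lim d j) = X / (sqrt W * sqrt W)"
    unfolding normalized_mu_lim_eq[OF d ij(1)] normalized_mu_lim_eq[OF d ij(2)] star_scale_left star_scale_right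
      divide_inverse inverse_mult_distrib
    by (simp only: X_def w_def W_def star_norm_def mult_ac)
  then have 1: "star Q (\<Gamma> d) (normalized_mu_lim d i) (normalized_mu_lim d j) = X / W"
    using W0 by simp
  \<comment> \<open>The limits of \<open>eta\<close> and of the cosine are constant in u, so this
    term is a multiple of the squared norm of the weight.\<close>
  have "star Q (\<Gamma> d) (\<lambda>u. w u * cos \<phi>0 * eta_lim i u) (\<lambda>u. w u * cos \<phi>0 * eta_lim j u)
    = star Q (\<Gamma> d) (\<lambda>u. (cos \<phi>0 * of_bool (i = 2)) * w u) (\<lambda>u. (cos \<phi>0 * of_bool (j = 2)) * w u)"
    unfolding eta_lim_def by (simp only: mult_ac)
  also have "\<dots> = (cos \<phi>0)\<^sup>2 * of_bool (i = 2 \<and> j = 2) * W"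
    unfolding star_scale_left star_scale_right by (simp add: W_def power2_eq_square)
  finally have 2: "star Q (\<Gamma> d) (\<lambda>u. w u * cos \<phi>0 * eta_lim i u) (\<lambda>u. w u * cos \<phi>0 * eta_lim j u)
    = (cos \<phi>0)\<^sup>2 * of_bool (i = 2 \<and> j = 2) * W" .
  show ?thesis
    unfolding T_mat_eq[OF W ij] 1 projected_xi_lim_eq[OF ij(1)] projected_xi_lim_eq[OF ij(2)]
      w_def[symmetric] W_def[symmetric] X_def[symmetric] 2
    using W0 by (simp add: distrib_left mult_ac)
qed

text \<open>The bracket of the information matrix, with open places for the functions that have
  limits. The weights stay tied to d, so the actual and the limiting matrix are two
  instances.\<close>

definition information :: "real \<Rightarrow> real \<Rightarrow> (nat \<Rightarrow> real \<Rightarrow> real) \<Rightarrow> (real \<Rightarrow> real) \<Rightarrow> (nat \<Rightarrow> real \<Rightarrow> real) \<Rightarrow>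
    (nat \<Rightarrow> real \<Rightarrow> real) \<Rightarrow> nat \<Rightarrow> nat \<Rightarrow> real \<Rightarrow> real"
  where "information L M \<mu> C \<eta> \<xi> i j d =
    L * star Q (\<Gamma> d) (\<lambda>u. wt Q \<alpha> (\<Gamma> d) u * \<mu> i u) (\<lambda>u. wt Q \<alpha> (\<Gamma> d) u * \<mu> j u)
    + M * star Q (\<Gamma> d) (\<lambda>u. wt Q \<alpha> (\<Gamma> d) u * C u * \<eta> i u) (\<lambda>u. wt Q \<alpha> (\<Gamma> d) u * C u * \<eta> j u)
    + (\<alpha> + 1)\<^sup>2 * star Q (\<Gamma> d) (proj_perp Q \<alpha> (\<Gamma> d) (\<lambda>u. vt Q \<alpha> (\<Gamma> d) u * \<xi> i u))
                 (proj_perp Q \<alpha> (\<Gamma> d) (\<lambda>u. vt Q \<alpha> (\<Gamma> d) u * \<xi> j u))"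

lemma information_lim:
  assumes ij: "i \<in> {1..2 * Q + 3}" "j \<in> {1..2 * Q + 3}"
  shows "((\<lambda>d. information L M (mu Q (\<Gamma> d)) (\<lambda>u. cos (phi Q (\<Gamma> d) u)) (eta Q (\<Gamma> d)) (xi Q (\<Gamma> d)) i j d
    - information L M mu_lim (\<lambda>u. cos \<phi>0) eta_lim xi_lim i j d) \<longlongrightarrow> 0) at_top"
proof -
  \<comment> \<open>Both instances use the same weights, so closeness of each weight to itself is
    enough.\<close>
  note w = close_refl[OF wt_bounded] and v = close_refl[OF vt_bounded]
  have lim: "((\<lambda>d. L * (star Q (\<Gamma> d) (\<lambda>u. wt Q \<alpha> (\<Gamma> d) u * mu Q (\<Gamma> d) i u) (\<lambda>u. wt Q \<alpha> (\<Gamma> d) u * mu Q (\<Gamma> d) j u)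
        - star Q (\<Gamma> d) (\<lambda>u. wt Q \<alpha> (\<Gamma> d) u * mu_lim i u) (\<lambda>u. wt Q \<alpha> (\<Gamma> d) u * mu_lim j u))
    + M * (star Q (\<Gamma> d) (\<lambda>u. wt Q \<alpha> (\<Gamma> d) u * cos (phi Q (\<Gamma> d) u) * eta Q (\<Gamma> d) i u)
            (\<lambda>u. wt Q \<alpha> (\<Gamma> d) u * cos (phi Q (\<Gamma> d) u) * eta Q (\<Gamma> d) j u)
        - star Q (\<Gamma> d) (\<lambda>u. wt Q \<alpha> (\<Gamma> d) u * cos \<phi>0 * eta_lim i u) (\<lambda>u. wt Q \<alpha> (\<Gamma> d) u * cos \<phi>0 * eta_lim j u))
    + (\<alpha> + 1)\<^sup>2 * (star Q (\<Gamma> d) (proj_perp Q \<alpha> (\<Gamma> d) (\<lambda>u. vt Q \<alpha> (\<Gamma> d) u * xi Q (\<Gamma> d) i u))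
                 (proj_perp Q \<alpha> (\<Gamma> d) (\<lambda>u. vt Q \<alpha> (\<Gamma> d) u * xi Q (\<Gamma> d) j u))
        - star Q (\<Gamma> d) (proj_perp Q \<alpha> (\<Gamma> d) (\<lambda>u. vt Q \<alpha> (\<Gamma> d) u * xi_lim i u))
                 (proj_perp Q \<alpha> (\<Gamma> d) (\<lambda>u. vt Q \<alpha> (\<Gamma> d) u * xi_lim j u)))) \<longlongrightarrow> L * 0 + M * 0 + (\<alpha> + 1)\<^sup>2 * 0) at_top"
    by (intro tendsto_add tendsto_mult tendsto_const star_close proj_perp_close close_mult
        w v mu_close eta_close xi_close cos_phi_close ij)
  then show ?thesis
    by (rule Lim_transform_eventually[OF _ always_eventually, THEN back_subst[of "\<lambda>z. (_ \<longlongrightarrow> z) _"]])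
      (auto simp: information_def algebra_simps)
qed

text \<open>An exact identity. The squared norm of the weight inside the energy cancels the
  normalization of the information matrix on one side, and on the other it is the factor that
  \<open>T_mat_star\<close> absorbs.\<close>

lemma efim_difference:
  assumes W: "star Q (\<Gamma> d) (wt Q \<alpha> (\<Gamma> d)) (wt Q \<alpha> (\<Gamma> d)) > 0" and d: "d > 0" and G: "G > 0"
    and ij: "i \<in> {1..2 * Q + 3}" "j \<in> {1..2 * Q + 3}"
  shows "efim Q \<alpha> B c N N0 G (\<Gamma> d) i j - 2 * energy Q \<alpha> N G (\<Gamma> d) / N0 *
      T_mat Q \<alpha> (L_const B c) (M_const N) (\<Gamma> d) i j =
    (2 * real N * G / N0) *
      (information (L_const B c) (M_const N) (mu Q (\<Gamma> d)) (\<lambda>u. cos (phi Q (\<Gamma> d) u)) (eta Q (\<Gamma> d)) (xi Q (\<Gamma> d)) i j d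
      - information (L_const B c) (M_const N) mu_lim (\<lambda>u. cos \<phi>0) eta_lim xi_lim i j d) * (1 / d ^ 4)"
proof -
  define W where "W = star Q (\<Gamma> d) (wt Q \<alpha> (\<Gamma> d)) (wt Q \<alpha> (\<Gamma> d))"
  define I where "I = information (L_const B c) (M_const N) (mu Q (\<Gamma> d)) (\<lambda>u. cos (phi Q (\<Gamma> d) u)) (eta Q (\<Gamma> d)) (xi Q (\<Gamma> d)) i j d"
  define T where "T = T_mat Q \<alpha> (L_const B c) (M_const N) (\<Gamma> d) i j"
  have W0: "W > 0" using W by (simp add: W_def)
  have E: "energy Q \<alpha> N G (\<Gamma> d) = G / d ^ 4 * real N * W"
    using G d by (simp add: energy_def gain_def \<Gamma>_simps star_norm_sq W_def power_divide flip: power_mult)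
  have J: "efim Q \<alpha> B c N N0 G (\<Gamma> d) i j = 1 / W * (2 * energy Q \<alpha> N G (\<Gamma> d) / N0) * I"
    by (simp add: efim_def star_norm_sq W_def I_def information_def)
  have T: "information (L_const B c) (M_const N) mu_lim (\<lambda>u. cos \<phi>0) eta_lim xi_lim i j d = W * T"
    unfolding information_def T_def W_def T_mat_star[OF W d ij] ..
  show ?thesis
    unfolding J I_def[symmetric] T_def[symmetric] T E
    using W0 by (simp add: right_diff_distrib diff_divide_distrib mult_ac)
qed

lemma efim_asymptotics:
  assumes G: "G > 0" and ij: "i \<in> {1..2 * Q + 3}" "j \<in> {1..2 * Q + 3}"
  shows "(\<lambda>d. efim Q \<alpha> B c N N0 G (\<Gamma> d) i j - 2 * energy Q \<alpha> N G (\<Gamma> d) / N0 *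
      T_mat Q \<alpha> (L_const B c) (M_const N) (\<Gamma> d) i j) \<in> o[at_top](\<lambda>d. 1 / d ^ 4)"
proof (rule smalloI_tendsto)
  obtain \<delta> where \<delta>: "\<delta> > 0"
      "\<forall>\<^sub>F d in at_top. star Q (\<Gamma> d) (wt Q \<alpha> (\<Gamma> d)) (wt Q \<alpha> (\<Gamma> d)) \<ge> \<delta>"
    using star_wt_lower by blast
  show "\<forall>\<^sub>F d in at_top. 1 / d ^ 4 \<noteq> (0 :: real)"
    using eventually_gt_at_top[of 0] by eventually_elim simp
  have "((\<lambda>d. (2 * real N * G / N0) *
      (information (L_const B c) (M_const N) (mu Q (\<Gamma> d)) (\<lambda>u. cos (phi Q (\<Gamma> d) u)) (eta Q (\<Gamma> d)) (xi Q (\<Gamma> d)) i j d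
      - information (L_const B c) (M_const N) mu_lim (\<lambda>u. cos \<phi>0) eta_lim xi_lim i j d)) \<longlongrightarrow> 0) at_top"
    by (intro tendsto_mult_right_zero information_lim ij)
  moreover have "\<forall>\<^sub>F d in at_top. (2 * real N * G / N0) *
      (information (L_const B c) (M_const N) (mu Q (\<Gamma> d)) (\<lambda>u. cos (phi Q (\<Gamma> d) u)) (eta Q (\<Gamma> d)) (xi Q (\<Gamma> d)) i j d
      - information (L_const B c) (M_const N) mu_lim (\<lambda>u. cos \<phi>0) eta_lim xi_lim i j d)
     = (efim Q \<alpha> B c N N0 G (\<Gamma> d) i j - 2 * energy Q \<alpha> N G (\<Gamma> d) / N0 *
      T_mat Q \<alpha> (L_const B c) (M_const N) (\<Gamma> d) i j) / (1 / d ^ 4)"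
    using \<delta>(2) eventually_gt_at_top[of 0]
  proof eventually_elim
    case (elim d)
    show ?case
      using \<delta>(1) elim G ij by (subst efim_difference) auto
  qed
  ultimately show "((\<lambda>d. (efim Q \<alpha> B c N N0 G (\<Gamma> d) i j - 2 * energy Q \<alpha> N G (\<Gamma> d) / N0 *
      T_mat Q \<alpha> (L_const B c) (M_const N) (\<Gamma> d) i j) / (1 / d ^ 4)) \<longlongrightarrow> 0) at_top"
    by (rule Lim_transform_eventually)
qed

end

theorem theorem2:
  fixes Q N :: nat and a b :: "nat \<Rightarrow> real"
    and \<phi>0 \<psi> \<alpha> B_RMS c N0 G :: real
  assumes "Q \<ge> 1" and "a 1 > 0" and "b 1 > 0"
    and "\<And>u. u \<in> {0..2 * pi} \<Longrightarrow> vector_derivative (rho Q a b) (at u) \<noteq> 0"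
    and "\<alpha> \<ge> 0"
    and "N \<ge> 1" and "N0 > 0" and "B_RMS > 0" and "c > 0" and "G > 0"
    and "i \<in> {1..2 * Q + 3}" and "j \<in> {1..2 * Q + 3}"
  shows "(\<lambda>d0. efim Q \<alpha> B_RMS c N N0 G (params Q d0 \<phi>0 \<psi> a b) i j
             - 2 * energy Q \<alpha> N G (params Q d0 \<phi>0 \<psi> a b) / N0
               * T_mat Q \<alpha> (L_const B_RMS c) (M_const N) (params Q d0 \<phi>0 \<psi> a b) i j)
         \<in> o[at_top](\<lambda>d0. 1 / d0 ^ 4)"
proof -
  interpret far_contour Q \<phi>0 \<psi> a b \<alpha>
    by unfold_locales (use assms(4,5) in auto)
  show ?thesis
    by (rule efim_asymptotics) (use assms in auto)
qed

end
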